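(* Let $k$, $(U,Q)$, $f$, $L$, $\beta$ be as below. There is a bijection between the set of $\mathrm{O}(U)(k)$-orbits (under conjugation) on $V_f(k)$ and the set of classes $\alpha\in(L^\times/L^{\times2})_{N=1}$ such that the bilinear form $\langle\,,\rangle_\alpha$ on $L$ is split.
   Context: $k$ is a field of characteristic not $2$; $(U,Q)$ is the split quadratic space over $k$ of dimension $2n+2$ and discriminant $1$, with bilinear form $\langle v,w\rangle=Q(v+w)-Q(v)-Q(w)$; $f\in k[x]$ is monic of degree $2n+2$ with no repeated roots; $V_f(k)$ is the set of $k$-linear operators $T$ on $U$ with $\langle Tv,w\rangle=\langle v,Tw\rangle$ and characteristic polynomial $f$. $L=k[x]/f(x)$ and $\beta$ is the image of $x$. $(L^\times/L^{\times2})_{N=1}$ is the kernel of the norm map $L^\times/L^{\times2}\to k^\times/k^{\times2}$. For $\alpha\in L^\times$, $\langle\lambda,\mu\rangle_\alpha=\mathrm{Tr}_{L/k}(\alpha\lambda\mu/f'(\beta))$ (the coefficient of $\beta^{2n+1}$ in $\alpha\lambda\mu$); whether it is split depends only on the class of $\alpha$ modulo squares. *)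

theory Defs
  imports "Jordan_Normal_Form.Char_Poly" "HOL-Computational_Algebra.Polynomial"
begin

(* ---------- The split quadratic space (U,Q) of dimension 2n+2 ----------
   U = k^(2n+2) (JNF vectors of dimension 2n+2), with the hyperbolic form
   Q(v) = sum_{i<=n} v_i v_{n+1+i}  (orthogonal sum of n+1 hyperbolic planes;
   split, discriminant 1). *)

definition splitQ :: "nat \<Rightarrow> 'k::field vec \<Rightarrow> 'k" where
  "splitQ n v = (\<Sum>i<Suc n. v $ i * v $ (Suc n + i))"

definition splitB :: "nat \<Rightarrow> 'k::field vec \<Rightarrow> 'k vec \<Rightarrow> 'k" where
  "splitB n v w = splitQ n (v + w) - splitQ n v - splitQ n w"

definition orth_group :: "nat \<Rightarrow> 'k::field mat set" where
  "orth_group n = {g \<in> carrier_mat (2*n+2) (2*n+2). invertible_mat g \<and>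
      (\<forall>v \<in> carrier_vec (2*n+2). splitQ n (g *\<^sub>v v) = splitQ n v)}"

definition Vf :: "nat \<Rightarrow> 'k::field poly \<Rightarrow> 'k mat set" where
  "Vf n f = {T \<in> carrier_mat (2*n+2) (2*n+2).
      (\<forall>v \<in> carrier_vec (2*n+2). \<forall>w \<in> carrier_vec (2*n+2).
          splitB n (T *\<^sub>v v) w = splitB n v (T *\<^sub>v w)) \<and>
      char_poly T = f}"

definition conj_rel :: "nat \<Rightarrow> 'k::field poly \<Rightarrow> ('k mat \<times> 'k mat) set" where
  "conj_rel n f = {(T, T'). T \<in> Vf n f \<and> T' \<in> Vf n f \<and>
      (\<exists>g \<in> orth_group n. T' * g = g * T)}"

definition orbits :: "nat \<Rightarrow> 'k::field poly \<Rightarrow> 'k mat set set" where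
  "orbits n f = Vf n f // conj_rel n f"

(* ---------- The algebra L = k[x]/f ----------
   Elements of L are represented by their reduced representatives, i.e.
   polynomials of degree < deg f; multiplication is multiplication mod f;
   beta is the class of x. *)

definition Lset :: "'k::field poly \<Rightarrow> 'k poly set" where
  "Lset f = {p. degree p < degree f}"

definition Lunits :: "'k::field poly \<Rightarrow> 'k poly set" where
  "Lunits f = {a \<in> Lset f. \<exists>b \<in> Lset f. (a * b) mod f = 1}"

definition sq_rel :: "'k::field poly \<Rightarrow> ('k poly \<times> 'k poly) set" where
  "sq_rel f = {(a, a'). a \<in> Lunits f \<and> a' \<in> Lunits f \<and>
      (\<exists>l \<in> Lunits f. a' = (a * l * l) mod f)}"

definition Lnorm :: "'k::field poly \<Rightarrow> 'k poly \<Rightarrow> 'k" where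
  "Lnorm f a = det (mat (degree f) (degree f)
                   (\<lambda>(i, j). coeff ((a * monom 1 j) mod f) i))"

(* class lies in the kernel of L^x/L^x2 -> k^x/k^x2 *)
definition norm_trivial :: "'k::field poly \<Rightarrow> 'k poly \<Rightarrow> bool" where
  "norm_trivial f a = (\<exists>c. c \<noteq> 0 \<and> Lnorm f a = c * c)"

(* <lambda,mu>_alpha = Tr(alpha lambda mu / f'(beta)) = coefficient of beta^(2n+1) in alpha lambda mu *)
definition form_alpha :: "'k::field poly \<Rightarrow> 'k poly \<Rightarrow> 'k poly \<Rightarrow> 'k poly \<Rightarrow> 'k" where
  "form_alpha f a l m = coeff ((a * l * m) mod f) (degree f - 1)"

definition form_split :: "nat \<Rightarrow> 'k::field poly \<Rightarrow> ('k poly \<Rightarrow> 'k poly \<Rightarrow> 'k) \<Rightarrow> bool" where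
  "form_split n f B =
     ((\<forall>l \<in> Lset f. (\<forall>m \<in> Lset f. B l m = 0) \<longrightarrow> l = 0) \<and>
      (\<exists>w :: nat \<Rightarrow> 'k poly.
          (\<forall>i < Suc n. w i \<in> Lset f) \<and>
          (\<forall>c :: nat \<Rightarrow> 'k. (\<Sum>i<Suc n. Polynomial.smult (c i) (w i)) = 0 \<longrightarrow> (\<forall>i < Suc n. c i = 0)) \<and>
          (\<forall>i < Suc n. \<forall>j < Suc n. B (w i) (w j) = 0)))"

definition split_classes :: "nat \<Rightarrow> 'k::field poly \<Rightarrow> 'k poly set set" where
  "split_classes n f = {C \<in> Lunits f // sq_rel f.
      \<forall>a \<in> C. norm_trivial f a \<and> form_split n f (form_alpha f a)}"

end

theory Submission
  imports Defs
begin

text \<open>Since \<open>f\<close> is squarefree, every \<open>T\<close> in \<open>V\<^sub>f(k)\<close> has a cyclic vector \<open>u\<close>, so \<open>p \<mapsto> p(T)u\<close> identifies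
  \<open>L\<close> with \<open>U\<close>. As \<open>T\<close> is self-adjoint, the form pulled back to \<open>L\<close> is a linear functional of the
  product, hence equal to \<open>\<langle>,\<rangle>\<^sub>\<alpha>\<close> for a unique unit \<open>\<alpha>\<close>. Two such identifications, for conjugate
  operators, differ by a matrix commuting with multiplication by \<open>\<beta>\<close>, that is by multiplication with
  a unit \<open>l\<close>, which changes \<open>\<alpha>\<close> to \<open>\<alpha>l\<^sup>2\<close>. Conversely, if \<open>\<langle>,\<rangle>\<^sub>\<alpha>\<close> is split, then \<open>L\<close> is isometric to \<open>U\<close>
  and multiplication by \<open>\<beta>\<close> is transported to an element of \<open>V\<^sub>f(k)\<close>. Comparing Gram determinants
  for \<open>\<alpha>\<close> and for \<open>1\<close> shows that the norm of \<open>\<alpha>\<close> is a square.\<close>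


section \<open>Cyclic vectors from squarefree characteristic polynomials\<close>

text \<open>In the basis of powers of \<beta>, multiplication by a and the form
  \<open>form_alpha f a\<close> become matrices \<open>Mul a\<close> and \<open>Gram a\<close> with
  \<open>Gram a * Mul b = Gram (a * b)\<close>; changing \<alpha> by a square and comparing
  determinants are then matrix identities. No map from operators to units is chosen, since \<alpha>
  depends on the cyclic vector: the proof works with a relation \<open>realizes\<close> between
  operators and units and passes to classes at the end. The norm comparison rests on the form for 1
  being split: two split Gram matrices of the same size are congruent, so their determinants differ
  by a square. Characteristic not 2 enters where an isotropic half is completed to a hyperbolic
  basis, which requires halving a Gram matrix, and where Q is recovered from its polar form. The
  cyclic vector is found without factoring f into irreducibles.\<close>

lemma obtain_inverse_mat:
  fixes A :: "'a :: field mat"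
  assumes A: "A \<in> carrier_mat n n" and d: "det A \<noteq> 0"
  obtains B where "B \<in> carrier_mat n n" "A * B = 1\<^sub>m n" "B * A = 1\<^sub>m n"
  using det_non_zero_imp_unit[OF A d, of "()"]
  by (auto simp: Units_def ring_mat_def)

text \<open>Horner's scheme. The sizes of the identity and zero matrices are read off from
  \<open>T\<close>, so no dimension has to be passed along.\<close>

definition pmat :: "'a::comm_ring_1 mat \<Rightarrow> 'a poly \<Rightarrow> 'a mat" where
  "pmat T p = fold_coeffs (\<lambda>a M. a \<cdot>\<^sub>m 1\<^sub>m (dim_row T) + T * M) p (0\<^sub>m (dim_row T) (dim_row T))"

lemma pmat_0: "pmat T 0 = 0\<^sub>m (dim_row T) (dim_row T)"
  by (simp add: pmat_def)

lemma pmat_pCons: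
  assumes T: "T \<in> carrier_mat n n"
  shows "pmat T (pCons a p) = a \<cdot>\<^sub>m 1\<^sub>m n + T * pmat T p"
proof (cases "a = 0 \<and> p = 0")
  case True
  have "0 \<cdot>\<^sub>m 1\<^sub>m n + T * 0\<^sub>m n n = 0\<^sub>m n n"
    using T by (intro eq_matI) auto
  then show ?thesis using T True by (simp add: pmat_0)
next
  case False
  then show ?thesis using T by (cases "p = 0") (auto simp: pmat_def)
qed

lemma pmat_carrier [simp]:
  assumes T: "T \<in> carrier_mat n n"
  shows "pmat T p \<in> carrier_mat n n"
proof (induction p)
  case 0
  then show ?case using T by (simp add: pmat_0)
next
  case (pCons a p)
  then show ?case using T by (simp add: pmat_pCons[OF T])
qed

lemma pmat_add:
  assumes T: "T \<in> carrier_mat n n"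
  shows "pmat T (p + q) = pmat T p + pmat T q"
proof (induction p arbitrary: q)
  case 0
  have "0\<^sub>m n n + pmat T q = pmat T q" using T by (intro left_add_zero_mat) simp
  then show ?case using T by (simp add: pmat_0)
next
  case (pCons a p)
  obtain b r where q: "q = pCons b r" by (cases q)
  have c: "pmat T p \<in> carrier_mat n n" "pmat T r \<in> carrier_mat n n" using T by auto
  have "pmat T (pCons a p + q) = (a + b) \<cdot>\<^sub>m 1\<^sub>m n + T * (pmat T p + pmat T r)"
    by (simp add: q pmat_pCons[OF T] pCons.IH)
  also have "T * (pmat T p + pmat T r) = T * pmat T p + T * pmat T r"
    by (rule mult_add_distrib_mat[OF T c])
  finally show ?case
    unfolding q pmat_pCons[OF T] using carrier_matD[OF c(1)] carrier_matD[OF c(2)] carrier_matD[OF T]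
    by (intro eq_matI) (auto simp: algebra_simps)
qed

lemma pmat_smult:
  assumes T: "T \<in> carrier_mat n n"
  shows "pmat T (Polynomial.smult c p) = c \<cdot>\<^sub>m pmat T p"
proof (induction p)
  case 0
  then show ?case using T by (simp add: pmat_0)
next
  case (pCons a p)
  have "T * (c \<cdot>\<^sub>m pmat T p) = c \<cdot>\<^sub>m (T * pmat T p)"
    by (rule mult_smult_distrib[OF T pmat_carrier[OF T]])
  then show ?case using carrier_matD[OF T] carrier_matD[OF pmat_carrier[OF T, of p]]
    by (simp add: pmat_pCons[OF T] pCons) (intro eq_matI, auto simp: algebra_simps)
qed

lemma pmat_mult:
  assumes T: "T \<in> carrier_mat n n"
  shows "pmat T (p * q) = pmat T p * pmat T q"
proof (induction p)
  case 0
  have "0\<^sub>m n n * pmat T q = 0\<^sub>m n n" using T by (intro left_mult_zero_mat) simp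
  then show ?case using T by (simp add: pmat_0)
next
  case (pCons a p)
  note c = pmat_carrier[OF T]
  have "pmat T (pCons a p * q) = pmat T (Polynomial.smult a q) + pmat T (pCons 0 (p * q))"
    by (simp add: pmat_add[OF T])
  also have "\<dots> = a \<cdot>\<^sub>m pmat T q + T * (pmat T p * pmat T q)"
  proof -
    have "0 \<cdot>\<^sub>m 1\<^sub>m n + T * (pmat T p * pmat T q) = T * (pmat T p * pmat T q)"
      using carrier_matD[OF T] carrier_matD[OF c] by (intro eq_matI) auto
    then show ?thesis by (simp add: pmat_smult[OF T] pmat_pCons[OF T] pCons)
  qed
  also have "T * (pmat T p * pmat T q) = T * pmat T p * pmat T q"
    by (rule assoc_mult_mat[symmetric, OF T c c])
  also have "a \<cdot>\<^sub>m pmat T q + T * pmat T p * pmat T q = (a \<cdot>\<^sub>m 1\<^sub>m n + T * pmat T p) * pmat T q"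
  proof -
    have "(a \<cdot>\<^sub>m 1\<^sub>m n + T * pmat T p) * pmat T q = (a \<cdot>\<^sub>m 1\<^sub>m n) * pmat T q + T * pmat T p * pmat T q"
      by (rule add_mult_distrib_mat[of _ n n _ _ n]) (use T c in auto)
    also have "(a \<cdot>\<^sub>m 1\<^sub>m n) * pmat T q = a \<cdot>\<^sub>m pmat T q"
      using mult_smult_assoc_mat[of "1\<^sub>m n" n n "pmat T q" n a] left_mult_one_mat[OF c] c by simp
    finally show ?thesis by simp
  qed
  finally show ?case by (simp add: pmat_pCons[OF T])
qed

lemma pmat_1:
  assumes T: "T \<in> carrier_mat n n"
  shows "pmat T 1 = 1\<^sub>m n"
  unfolding one_pCons pmat_pCons[OF T] pmat_0
  using T by (intro eq_matI) auto

lemma pmat_X: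
  assumes T: "T \<in> carrier_mat n n"
  shows "pmat T (monom 1 1) = T"
  unfolding x_as_monom[symmetric] pmat_pCons[OF T] pmat_0
  using T by (intro eq_matI) auto

text \<open>A factor theorem: x - T divides p(x) - p(T) because x commutes with T. The quotient is
  built along Horner's scheme from x p - T p(T) = x (p - p(T)) + (x - T) p(T), so Q becomes x Q +
  p(T).\<close>

lemma char_poly_matrix_dvd:
  fixes T :: "'a :: comm_ring_1 mat"
  assumes T: "T \<in> carrier_mat n n"
  shows "\<exists>Q \<in> carrier_mat n n. p \<cdot>\<^sub>m 1\<^sub>m n - map_mat (\<lambda>a. [:a:]) (pmat T p) = char_poly_matrix T * Q"
proof (induction p)
  case 0
  have "(0 :: 'a poly) \<cdot>\<^sub>m 1\<^sub>m n - map_mat (\<lambda>a. [:a:]) (pmat T 0) = char_poly_matrix T * 0\<^sub>m n n"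
    using carrier_matD[OF T] carrier_matD[OF char_poly_matrix_closed[OF T]] by (intro eq_matI) (auto simp: pmat_0)
  then show ?case by (intro bexI[of _ "0\<^sub>m n n"]) auto
next
  case (pCons a p)
  let ?K = "map_mat (\<lambda>a::'a. [:a:])" and ?X = "[:0, 1:] :: 'a poly" and ?A = "char_poly_matrix T"
  from pCons obtain Q where Q: "Q \<in> carrier_mat n n"
    and eq: "p \<cdot>\<^sub>m 1\<^sub>m n - ?K (pmat T p) = ?A * Q" by blast
  note c = pmat_carrier[OF T, of p]
  have c': "?K (pmat T p) \<in> carrier_mat n n" and T': "?K T \<in> carrier_mat n n" using c T by auto
  have A: "?A \<in> carrier_mat n n" using T by simp
  have A': "?A = ?X \<cdot>\<^sub>m 1\<^sub>m n - ?K T"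
    using T by (intro eq_matI) (auto simp: char_poly_matrix_def)
  interpret K: semiring_hom "\<lambda>a::'a. [:a:]" by unfold_locales (auto simp: one_pCons)
  have KT: "?K (T * pmat T p) = ?K T * ?K (pmat T p)"
    by (rule K.mat_hom_mult[OF T c])
  have "?A * (?X \<cdot>\<^sub>m Q + ?K (pmat T p)) = ?A * (?X \<cdot>\<^sub>m Q) + ?A * ?K (pmat T p)"
    by (rule mult_add_distrib_mat[OF A _ c']) (use Q in simp)
  also have "?A * (?X \<cdot>\<^sub>m Q) = ?X \<cdot>\<^sub>m (p \<cdot>\<^sub>m 1\<^sub>m n - ?K (pmat T p))"
    by (simp only: mult_smult_distrib[OF A Q] eq)
  also have "?A * ?K (pmat T p) = (?X \<cdot>\<^sub>m 1\<^sub>m n) * ?K (pmat T p) - ?K T * ?K (pmat T p)"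
    unfolding A' by (rule minus_mult_distrib_mat[OF _ T' c']) simp
  also have "(?X \<cdot>\<^sub>m 1\<^sub>m n) * ?K (pmat T p) = ?X \<cdot>\<^sub>m ?K (pmat T p)"
    using mult_smult_assoc_mat[of "1\<^sub>m n" n n "?K (pmat T p)" n ?X] c' by simp
  finally have "?A * (?X \<cdot>\<^sub>m Q + ?K (pmat T p)) = pCons a p \<cdot>\<^sub>m 1\<^sub>m n - ?K (pmat T (pCons a p))"
    unfolding pmat_pCons[OF T] KT[symmetric] using carrier_matD[OF T] carrier_matD[OF c]
    by (intro eq_matI) (auto simp: algebra_simps)
  moreover have "?X \<cdot>\<^sub>m Q + ?K (pmat T p) \<in> carrier_mat n n" using Q c' by auto
  ultimately show ?case by metis
qed

text \<open>\<open>hI - h(T)\<close> is a multiple of \<open>xI - T\<close>, so its determinant is divisible by \<open>h\<close>; modulo \<open>h\<close> that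
  determinant is the constant \<open>det (- h(T))\<close>.\<close>

lemma pmat_singular:
  fixes T :: "'a :: field mat"
  assumes T: "T \<in> carrier_mat n n" and h: "h dvd char_poly T" "degree h > 0"
  obtains v where "v \<in> carrier_vec n" "v \<noteq> 0\<^sub>v n" "pmat T h *\<^sub>v v = 0\<^sub>v n"
proof -
  let ?K = "map_mat (\<lambda>a::'a. [:a:])"
  let ?C = "pmat T h"
  note C = pmat_carrier[OF T, of h]
  obtain Q where Q: "Q \<in> carrier_mat n n"
    and eq: "h \<cdot>\<^sub>m 1\<^sub>m n - ?K ?C = char_poly_matrix T * Q"
    using char_poly_matrix_dvd[OF T] by blast
  have H: "comm_ring_hom (\<lambda>p. pcompose p h)" by unfold_locales
  \<comment> \<open>This is the characteristic matrix of \<open>?C\<close> with h substituted for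
    the variable. Its determinant is therefore \<open>char_poly ?C\<close> composed with h, whose
    residue modulo h is the constant term.\<close>
  have "h \<cdot>\<^sub>m 1\<^sub>m n - ?K ?C = map_mat (\<lambda>p. pcompose p h) (char_poly_matrix ?C)"
    using C by (intro eq_matI) (auto simp: char_poly_matrix_def pcompose_pCons pcompose_add)
  then have "pcompose (char_poly ?C) h = det (h \<cdot>\<^sub>m 1\<^sub>m n - ?K ?C)"
    unfolding char_poly_def by (simp only: comm_ring_hom.hom_det[OF H])
  also have "\<dots> = char_poly T * det Q"
    unfolding eq char_poly_def by (rule det_mult[OF _ Q]) (use T in simp)
  finally have "h dvd pcompose (char_poly ?C) h" using h(1) by simp
  moreover obtain a q where q: "char_poly ?C = pCons a q" by (cases "char_poly ?C")
  ultimately have "h dvd [:a:] + h * pcompose q h" by (simp add: pcompose_pCons)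
  then have "h dvd [:a:]" by (simp add: dvd_add_left_iff)
  then have "a = 0" using h(2) by (metis dvd_imp_degree_le degree_pCons_0 not_le pCons_eq_0_iff)
  then have "poly (char_poly ?C) 0 = 0" by (simp add: q)
  then obtain v where "v \<in> carrier_vec n" "v \<noteq> 0\<^sub>v n" "?C *\<^sub>v v = 0 \<cdot>\<^sub>v v"
    unfolding eigenvalue_root_char_poly[OF C, symmetric] eigenvalue_def eigenvector_def
    using C T by auto
  moreover have "0 \<cdot>\<^sub>v v = 0\<^sub>v n" using \<open>v \<in> carrier_vec n\<close> by (intro eq_vecI) auto
  ultimately show thesis using that by metis
qed


text \<open>A nonzero element of least degree generates, by division with remainder. It serves both
  for Bezout identities and for annihilators of vectors.\<close>

lemma poly_ideal_principal:
  fixes I :: "'a :: field poly set"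
  assumes 0: "0 \<in> I" and add: "\<And>p q. p \<in> I \<Longrightarrow> q \<in> I \<Longrightarrow> p + q \<in> I"
    and mult: "\<And>p q. p \<in> I \<Longrightarrow> q * p \<in> I"
  obtains d where "\<And>p. p \<in> I \<longleftrightarrow> d dvd p"
proof (cases "I = {0}")
  case True
  then show thesis using that[of 0] by auto
next
  case False
  then obtain p0 where p0: "p0 \<in> I \<and> p0 \<noteq> 0" using 0 by blast
  obtain d where d: "d \<in> I" "d \<noteq> 0" and min: "\<And>p. p \<in> I \<Longrightarrow> p \<noteq> 0 \<Longrightarrow> degree d \<le> degree p"
    using ex_has_least_nat[of "\<lambda>p. p \<in> I \<and> p \<noteq> 0" p0 degree, OF p0] by blast
  have "p \<in> I \<longleftrightarrow> d dvd p" for p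
  proof
    assume p: "p \<in> I"
    have "p mod d = p + (- (p div d)) * d" by (simp add: minus_div_mult_eq_mod[symmetric])
    also have "\<dots> \<in> I" using add mult p d(1) by blast
    finally have "p mod d \<in> I" .
    moreover have "p mod d = 0 \<or> degree (p mod d) < degree d" using d(2) by (rule degree_mod_less)
    ultimately have "p mod d = 0" using min[of "p mod d"] by fastforce
    then show "d dvd p" by auto
  next
    assume "d dvd p"
    then show "p \<in> I" using mult[OF d(1)] by (auto simp: dvd_def mult.commute)
  qed
  with that show thesis by blast
qed

text \<open>The combinations of a and b form an ideal; its generator divides both a and b, hence is
  a unit.\<close>

lemma coprime_poly_bezout:
  fixes a b :: "'a :: field poly"
  assumes "coprime a b"
  obtains r s where "r * a + s * b = 1"
proof -
  let ?I = "{r * a + s * b | r s. True}"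
  obtain d where d: "\<And>p. p \<in> ?I \<longleftrightarrow> d dvd p"
  proof (rule poly_ideal_principal[of ?I])
    show "0 \<in> ?I" by (auto intro!: exI[of _ 0])
    show "p + q \<in> ?I" if "p \<in> ?I" "q \<in> ?I" for p q
    proof -
      from that obtain r s r' s' where "p = r * a + s * b" "q = r' * a + s' * b" by blast
      then have "p + q = (r + r') * a + (s + s') * b" by (simp add: algebra_simps)
      then show ?thesis by blast
    qed
    show "q * p \<in> ?I" if "p \<in> ?I" for p q
    proof -
      from that obtain r s where "p = r * a + s * b" by blast
      then have "q * p = (q * r) * a + (q * s) * b" by (simp add: algebra_simps)
      then show ?thesis by blast
    qed
  qed blast
  have "a = 1 * a + 0 * b" "b = 0 * a + 1 * b" by auto
  then have "a \<in> ?I" "b \<in> ?I" by blast+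
  then have "is_unit d" using d coprime_common_divisor[OF assms] by blast
  then have "1 \<in> ?I" using d by blast
  then show thesis using that by force
qed

lemma coprime_poly_dvd_cancel:
  fixes a b c :: "'a :: field poly"
  assumes "coprime a b" "a dvd b * c"
  shows "a dvd c"
proof -
  obtain r s where rs: "r * a + s * b = 1" using coprime_poly_bezout[OF assms(1)] .
  have "c = (r * a + s * b) * c" using rs by simp
  also have "\<dots> = a * (r * c) + s * (b * c)" by (simp add: algebra_simps)
  finally show ?thesis using assms(2) by (metis dvd_add dvd_mult dvd_triv_left)
qed

lemma pmat_mult_vec:
  fixes T :: "'a :: field mat"
  assumes "T \<in> carrier_mat n n" "v \<in> carrier_vec n"
  shows "pmat T (p * q) *\<^sub>v v = pmat T p *\<^sub>v (pmat T q *\<^sub>v v)"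
  unfolding pmat_mult[OF assms(1)] by (rule assoc_mult_mat_vec[of _ n n _ n]) (use assms in auto)

text \<open>If the annihilators of \<open>u\<close> and \<open>v\<close> are generated by coprime polynomials, then the annihilator
  of \<open>u + v\<close> is generated by their product. If the annihilator of \<open>u\<close> is generated by a proper
  divisor \<open>g\<close> of \<open>f = g * h\<close>, it can thus be enlarged with a vector \<open>v\<close> killed by \<open>h(T)\<close>.\<close>

lemma squarefree_char_poly_cyclic:
  fixes T :: "'a :: field mat"
  assumes T: "T \<in> carrier_mat n n" and sqf: "coprime (char_poly T) (pderiv (char_poly T))"
  obtains u where "u \<in> carrier_vec n" "\<And>p. pmat T p *\<^sub>v u = 0\<^sub>v n \<longleftrightarrow> char_poly T dvd p"
proof -
  define f where "f = char_poly T"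
  have f0: "f \<noteq> 0" using degree_monic_char_poly[OF T] by (auto simp: f_def)
  \<comment> \<open>By the product rule a common divisor of g and h divides f and its derivative, so
    complementary factors of f are coprime.\<close>
  have copr: "coprime g h" if "f = g * h" for g h
  proof (rule coprimeI)
    fix c assume c: "c dvd g" "c dvd h"
    then have "c dvd f" "c dvd pderiv f" by (auto simp: that pderiv_mult)
    then show "is_unit c" using sqf coprime_common_divisor unfolding f_def by blast
  qed
  note pc = pmat_carrier[OF T]
  have extend: "\<exists>u \<in> carrier_vec n. \<forall>p. pmat T p *\<^sub>v u = 0\<^sub>v n \<longleftrightarrow> f dvd p"
    if "u \<in> carrier_vec n" "\<forall>p. pmat T p *\<^sub>v u = 0\<^sub>v n \<longleftrightarrow> g dvd p" "g dvd f" for u g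
    using that
  proof (induction "degree f - degree g" arbitrary: u g rule: less_induct)
    case less
    note u = less.prems(1) and ann_u = less.prems(2)[rule_format]
    from less.prems(3) obtain h where h: "f = g * h" by blast
    have gh0: "g \<noteq> 0" "h \<noteq> 0" using f0 h by auto
    show ?case
    proof (cases "degree h = 0")
      case True
      then have "h dvd 1" using gh0(2) is_unit_iff_degree by blast
      then have "f dvd g" unfolding h by (metis mult_dvd_mono dvd_refl mult.right_neutral)
      then have "g dvd p \<longleftrightarrow> f dvd p" for p using less.prems(3) dvd_trans by blast
      then show ?thesis using less.prems by blast
    next
      case False
      have "h dvd char_poly T" using h by (simp add: f_def)
      then obtain v where v: "v \<in> carrier_vec n" "v \<noteq> 0\<^sub>v n" and hv: "pmat T h *\<^sub>v v = 0\<^sub>v n"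
        using pmat_singular[OF T] False by blast
      obtain d where d: "\<And>p. p \<in> {p. pmat T p *\<^sub>v v = 0\<^sub>v n} \<longleftrightarrow> d dvd p"
      proof (rule poly_ideal_principal[of "{p. pmat T p *\<^sub>v v = 0\<^sub>v n}"])
        show "0 \<in> {p. pmat T p *\<^sub>v v = 0\<^sub>v n}" using T v by (auto simp: pmat_0)
        show "p + q \<in> {p. pmat T p *\<^sub>v v = 0\<^sub>v n}"
          if "p \<in> {p. pmat T p *\<^sub>v v = 0\<^sub>v n}" "q \<in> {p. pmat T p *\<^sub>v v = 0\<^sub>v n}" for p q
          using that by (simp add: pmat_add[OF T] add_mult_distrib_mat_vec[OF pc pc v(1)])
        show "q * p \<in> {p. pmat T p *\<^sub>v v = 0\<^sub>v n}" if "p \<in> {p. pmat T p *\<^sub>v v = 0\<^sub>v n}" for p q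
          using that pc[of q] by (auto simp: pmat_mult_vec[OF T v(1)])
      qed blast
      then have ann_v: "\<And>p. pmat T p *\<^sub>v v = 0\<^sub>v n \<longleftrightarrow> d dvd p" by simp
      \<comment> \<open>As v is nonzero, d is not a unit; hence g * d has larger degree than g and
        the induction measure drops.\<close>
      have "\<not> d dvd 1" using ann_v[of 1] v T by (simp add: pmat_1[OF T])
      have "d dvd h" using ann_v hv by blast
      then have d0: "d \<noteq> 0" using gh0 by auto
      then have dd: "degree d > 0" using \<open>\<not> d dvd 1\<close> is_unit_iff_degree by blast
      have "g * d dvd f" using \<open>d dvd h\<close> by (simp add: h)
      have cop: "coprime g d" using copr[OF h] \<open>d dvd h\<close> by (meson coprime_divisors dvd_refl)
      have uv: "u + v \<in> carrier_vec n" using u v by simp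
      have ann_uv: "pmat T p *\<^sub>v (u + v) = 0\<^sub>v n \<longleftrightarrow> g * d dvd p" for p
      proof
        assume "g * d dvd p"
        then have "g dvd p" "d dvd p" using dvd_mult_left dvd_mult_right by blast+
        then have "pmat T p *\<^sub>v u = 0\<^sub>v n" "pmat T p *\<^sub>v v = 0\<^sub>v n" using ann_u ann_v by auto
        then show "pmat T p *\<^sub>v (u + v) = 0\<^sub>v n"
          by (simp add: mult_add_distrib_mat_vec[OF pc u v(1)])
      next
        assume "pmat T p *\<^sub>v (u + v) = 0\<^sub>v n"
        then have z: "pmat T (q * p) *\<^sub>v u + pmat T (q * p) *\<^sub>v v = 0\<^sub>v n" for q
          using pmat_mult_vec[OF T uv, of q p] mult_add_distrib_mat_vec[OF pc u v(1), of "q * p"] pc[of q]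
          by auto
        have cu: "pmat T q *\<^sub>v u \<in> carrier_vec n" and cv: "pmat T q *\<^sub>v v \<in> carrier_vec n" for q
          using u v pc[of q] by auto
        \<comment> \<open>Multiplying by d removes the contribution of v and leaves a condition on u
          alone; multiplying by g does the reverse. Coprimality then cancels the extra
          factor.\<close>
        have "pmat T (d * p) *\<^sub>v v = 0\<^sub>v n" using ann_v by simp
        then have "pmat T (d * p) *\<^sub>v u = 0\<^sub>v n" using z[of d] cu[of "d * p"] by simp
        then have "g dvd d * p" using ann_u by blast
        then have "g dvd p" using coprime_poly_dvd_cancel[OF cop] by blast
        have "pmat T (g * p) *\<^sub>v u = 0\<^sub>v n" using ann_u by simp
        then have "pmat T (g * p) *\<^sub>v v = 0\<^sub>v n" using z[of g] cv[of "g * p"] by simp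
        then have "d dvd g * p" using ann_v by blast
        then have "d dvd p" using coprime_poly_dvd_cancel cop coprime_commute by blast
        obtain r where r: "p = g * r" using \<open>g dvd p\<close> by blast
        have "d dvd r" using coprime_poly_dvd_cancel[of d g r] cop \<open>d dvd p\<close> r
          by (simp add: coprime_commute)
        then show "g * d dvd p" unfolding r by simp
      qed
      have deg: "degree (g * d) = degree g + degree d" using gh0 d0 by (simp add: degree_mult_eq)
      have "degree (g * d) \<le> degree f" using \<open>g * d dvd f\<close> f0 dvd_imp_degree_le by blast
      then have "degree f - degree (g * d) < degree f - degree g" using deg dd by simp
      then show ?thesis using less.hyps[OF _ uv] ann_uv \<open>g * d dvd f\<close> by blast
    qed
  qed
  \<comment> \<open>The enlargement starts at the zero vector, whose annihilator is generated by
    1.\<close>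
  have "\<forall>p. pmat T p *\<^sub>v 0\<^sub>v n = 0\<^sub>v n \<longleftrightarrow> 1 dvd p"
    using carrier_matD[OF pc] by (auto simp: scalar_prod_def)
  then obtain u where "u \<in> carrier_vec n" "\<forall>p. pmat T p *\<^sub>v u = 0\<^sub>v n \<longleftrightarrow> f dvd p"
    using extend[of "0\<^sub>v n" 1] by auto
  then show thesis using that f_def by blast
qed


section \<open>Matrices over the quotient algebra \<open>k[x]/f\<close>\<close>

definition vec_of_poly :: "nat \<Rightarrow> 'a::zero poly \<Rightarrow> 'a vec" where
  "vec_of_poly N p = vec N (coeff p)"

definition coeffs_poly :: "'a::comm_monoid_add vec \<Rightarrow> 'a poly" where
  "coeffs_poly v = (\<Sum>i<dim_vec v. monom (v $ i) i)"

lemma vec_of_poly_carrier [simp]: "vec_of_poly N p \<in> carrier_vec N"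
  and vec_of_poly_dim [simp]: "dim_vec (vec_of_poly N p) = N"
  by (simp_all add: vec_of_poly_def)

lemma vec_of_poly_index [simp]: "i < N \<Longrightarrow> vec_of_poly N p $ i = coeff p i"
  by (simp add: vec_of_poly_def)

lemma coeff_coeffs_poly: "coeff (coeffs_poly v) i = (if i < dim_vec v then v $ i else 0)"
  unfolding coeffs_poly_def coeff_sum coeff_monom by (simp add: sum.delta')

lemma vec_of_coeffs_poly [simp]: "v \<in> carrier_vec N \<Longrightarrow> vec_of_poly N (coeffs_poly v) = v"
  by (intro eq_vecI) (auto simp: coeff_coeffs_poly)

lemma degree_coeffs_poly: "v \<in> carrier_vec N \<Longrightarrow> 0 < N \<Longrightarrow> degree (coeffs_poly v) < N"
  by (auto simp: coeff_coeffs_poly intro!: degree_lessI)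

lemma vec_of_poly_inj:
  assumes "degree p < N" "degree q < N" "vec_of_poly N p = vec_of_poly N q"
  shows "p = q"
proof (rule poly_eqI)
  fix i
  show "coeff p i = coeff q i"
  proof (cases "i < N")
    case True
    then show ?thesis using arg_cong[OF assms(3), of "\<lambda>v. v $ i"] by simp
  next
    case False
    then show ?thesis using assms by (simp add: coeff_eq_0)
  qed
qed

lemma unit_vec_of_poly: "j < N \<Longrightarrow> vec_of_poly N (monom 1 j) = unit_vec N j"
  by (intro eq_vecI) (auto simp: unit_vec_def)

lemma eq_mat_mult_vecI:
  fixes A B :: "'a::comm_ring_1 mat"
  assumes A: "A \<in> carrier_mat M N" and B: "B \<in> carrier_mat M N"
    and eq: "\<And>v. v \<in> carrier_vec N \<Longrightarrow> A *\<^sub>v v = B *\<^sub>v v"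
  shows "A = B"
proof (rule eq_matI)
  fix i j assume ij: "i < dim_row B" "j < dim_col B"
  have "(A *\<^sub>v unit_vec N j) $ i = (B *\<^sub>v unit_vec N j) $ i" using eq by simp
  then show "A $$ (i, j) = B $$ (i, j)" using A B ij by (simp add: scalar_prod_right_unit)
qed (use A B in auto)

lemma eq_mat_bilinearI:
  fixes A B :: "'a::comm_ring_1 mat"
  assumes A: "A \<in> carrier_mat N N" and B: "B \<in> carrier_mat N N"
    and eq: "\<And>v w. v \<in> carrier_vec N \<Longrightarrow> w \<in> carrier_vec N \<Longrightarrow> v \<bullet> (A *\<^sub>v w) = v \<bullet> (B *\<^sub>v w)"
  shows "A = B"
proof (rule eq_mat_mult_vecI[OF A B], rule eq_vecI)
  fix v :: "'a vec" and i assume v: "v \<in> carrier_vec N" and i: "i < dim_vec (B *\<^sub>v v)"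
  have "unit_vec N i \<bullet> (A *\<^sub>v v) = unit_vec N i \<bullet> (B *\<^sub>v v)" using eq v by simp
  then show "(A *\<^sub>v v) $ i = (B *\<^sub>v v) $ i" using A B v i
    by (simp add: scalar_prod_left_unit[of _ N])
qed (use A B in auto)

lemma scalar_prod_mult_transpose:
  fixes A :: "'a::comm_ring_1 mat"
  assumes A: "A \<in> carrier_mat n m" and v: "v \<in> carrier_vec m" and w: "w \<in> carrier_vec n"
  shows "(A *\<^sub>v v) \<bullet> w = v \<bullet> (A\<^sup>T *\<^sub>v w)"
  using transpose_vec_mult_scalar[of "A\<^sup>T" m n w v] A v w by simp

lemma eq_mat_polyI:
  fixes A B :: "'a::field mat"
  assumes A: "A \<in> carrier_mat M N" and B: "B \<in> carrier_mat M N" and N: "0 < N"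
    and eq: "\<And>p. degree p < N \<Longrightarrow> A *\<^sub>v vec_of_poly N p = B *\<^sub>v vec_of_poly N p"
  shows "A = B"
  using eq[OF degree_coeffs_poly[OF _ N]] by (intro eq_mat_mult_vecI[OF A B]) simp

lemma scalar_prod_vec_of_poly:
  fixes v :: "'a::comm_ring_1 vec"
  assumes "v \<in> carrier_vec N"
  shows "v \<bullet> vec_of_poly N p = (\<Sum>j<N. coeff p j * v $ j)"
  by (simp add: scalar_prod_def lessThan_atLeast0 mult.commute)

lemma poly_as_sum_lessThan:
  fixes p :: "'a::comm_ring_1 poly"
  assumes "degree p < N"
  shows "(\<Sum>j<N. Polynomial.smult (coeff p j) (monom 1 j)) = p"
proof (rule poly_eqI)
  fix i
  have "coeff (\<Sum>j<N. Polynomial.smult (coeff p j) (monom 1 j)) i = (\<Sum>j<N. if j = i then coeff p j else 0)"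
    by (simp add: coeff_sum if_distrib cong: if_cong)
  also have "\<dots> = coeff p i" using assms by (auto simp: coeff_eq_0)
  finally show "coeff (\<Sum>j<N. Polynomial.smult (coeff p j) (monom 1 j)) i = coeff p i" .
qed

lemma mod_poly_sum:
  fixes f :: "'a::field poly"
  shows "(\<Sum>j\<in>A. Polynomial.smult (c j) (g j)) mod f = (\<Sum>j\<in>A. Polynomial.smult (c j) (g j mod f))"
  by (induction A rule: infinite_finite_induct) (auto simp: poly_mod_add_left mod_smult_left)

section \<open>Multiplication and trace forms on L in coordinates\<close>

locale poly_quotient =
  fixes f :: "'k::field poly" and N :: nat
  assumes monic: "lead_coeff f = 1" and deg: "degree f = N" and N_pos: "0 < N"
begin

abbreviation cv where "cv \<equiv> vec_of_poly N"

text \<open>The matrix inside \<open>Lnorm\<close>: column j holds the coordinates of a \<beta>^j.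
  It is the regular representation of L, so the norm is its determinant.\<close>

definition Mul :: "'k poly \<Rightarrow> 'k mat" where
  "Mul a = mat N N (\<lambda>(i, j). coeff ((a * monom 1 j) mod f) i)"

definition Gram :: "'k poly \<Rightarrow> 'k mat" where
  "Gram a = mat N N (\<lambda>(i, j). form_alpha f a (monom 1 i) (monom 1 j))"

lemma f_nz: "f \<noteq> 0" using monic by auto

lemma Lset_iff: "p \<in> Lset f \<longleftrightarrow> degree p < N"
  by (simp add: Lset_def deg)

lemma mod_Lset [simp]: "degree (p mod f) < N"
  using degree_mod_less[OF f_nz, of p] N_pos deg by auto

lemma mod_id: "degree p < N \<Longrightarrow> p mod f = p"
  by (simp add: mod_poly_less deg)

lemma Mul_carrier [simp]: "Mul a \<in> carrier_mat N N"
  and Gram_carrier [simp]: "Gram a \<in> carrier_mat N N"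
  by (simp_all add: Mul_def Gram_def)

lemma Mul_Gram_dim [simp]:
  "dim_row (Mul a) = N" "dim_col (Mul a) = N" "dim_row (Gram a) = N" "dim_col (Gram a) = N"
  by (simp_all add: Mul_def Gram_def)

lemma Lnorm_eq: "Lnorm f a = det (Mul a)"
  by (simp add: Lnorm_def Mul_def deg)

lemma mod_mult_expand:
  assumes "degree p < N"
  shows "(a * p) mod f = (\<Sum>j<N. Polynomial.smult (coeff p j) ((a * monom 1 j) mod f))"
proof -
  have "a * p = a * (\<Sum>j<N. Polynomial.smult (coeff p j) (monom 1 j))"
    by (simp add: poly_as_sum_lessThan[OF assms])
  also have "\<dots> = (\<Sum>j<N. Polynomial.smult (coeff p j) (a * monom 1 j))"
    by (simp add: sum_distrib_left)
  finally show ?thesis by (simp add: mod_poly_sum)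
qed

lemma Mul_cv:
  assumes "degree p < N"
  shows "Mul a *\<^sub>v cv p = cv ((a * p) mod f)"
proof (rule eq_vecI)
  fix i assume "i < dim_vec (cv ((a * p) mod f))"
  then have i: "i < N" by simp
  have "(Mul a *\<^sub>v cv p) $ i = (\<Sum>j<N. coeff p j * row (Mul a) i $ j)"
    using i row_carrier[of "Mul a" i] by (simp add: scalar_prod_vec_of_poly)
  also have "\<dots> = (\<Sum>j<N. coeff p j * coeff ((a * monom 1 j) mod f) i)"
    using i by (intro sum.cong) (auto simp: Mul_def)
  also have "\<dots> = coeff ((a * p) mod f) i"
    unfolding mod_mult_expand[OF assms] by (simp add: coeff_sum)
  finally show "(Mul a *\<^sub>v cv p) $ i = cv ((a * p) mod f) $ i" using i by simp
qed (use Mul_carrier[of a] in auto)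

lemma Mul_eqI: "A \<in> carrier_mat N N \<Longrightarrow> (\<And>p. degree p < N \<Longrightarrow> A *\<^sub>v cv p = cv ((a * p) mod f)) \<Longrightarrow> A = Mul a"
  by (rule eq_mat_polyI[of _ N N]) (auto simp: Mul_cv N_pos)

lemma Mul_mult: "Mul a * Mul b = Mul (a * b)"
proof (rule Mul_eqI)
  fix p :: "'k poly" assume p: "degree p < N"
  have "(Mul a * Mul b) *\<^sub>v cv p = Mul a *\<^sub>v (Mul b *\<^sub>v cv p)"
    by (rule assoc_mult_mat_vec[of _ N N _ N]) auto
  also have "\<dots> = cv ((a * ((b * p) mod f)) mod f)" using p by (simp add: Mul_cv)
  also have "(a * ((b * p) mod f)) mod f = (a * b * p) mod f"
    by (simp add: mod_mult_right_eq mult.assoc)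
  finally show "(Mul a * Mul b) *\<^sub>v cv p = cv ((a * b * p) mod f)" .
qed (auto intro: mult_carrier_mat)

lemma Mul_1: "Mul 1 = 1\<^sub>m N"
  by (rule Mul_eqI[symmetric]) (auto simp: mod_id)

lemma Mul_mod: "Mul (a mod f) = Mul a"
  by (rule Mul_eqI) (auto simp: Mul_cv mod_mult_left_eq)

lemma Mul_inj:
  assumes "Mul a = Mul b"
  shows "a mod f = b mod f"
proof -
  have "Mul a *\<^sub>v cv 1 = Mul b *\<^sub>v cv 1" using assms by simp
  then have "cv (a mod f) = cv (b mod f)" using N_pos by (simp add: Mul_cv)
  then show ?thesis by (intro vec_of_poly_inj[of _ N]) auto
qed

text \<open>If multiplication by a is invertible, the preimage of 1 is an inverse of a; conversely
  an inverse of a gives an inverse matrix. Units thus become a determinant condition, comparable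
  with nondegeneracy of forms.\<close>

lemma Lunits_iff: "a \<in> Lunits f \<longleftrightarrow> degree a < N \<and> det (Mul a) \<noteq> 0"
proof
  assume a: "a \<in> Lunits f"
  then obtain b where b: "(a * b) mod f = 1" by (auto simp: Lunits_def)
  have "Mul a * Mul b = 1\<^sub>m N" using Mul_mod[of "a * b"] b by (simp add: Mul_mult Mul_1)
  then have "det (Mul a) * det (Mul b) = 1"
    by (metis det_mult Mul_carrier det_one)
  then show "degree a < N \<and> det (Mul a) \<noteq> 0" using a by (auto simp: Lunits_def Lset_iff)
next
  assume a: "degree a < N \<and> det (Mul a) \<noteq> 0"
  then obtain B where B: "B \<in> carrier_mat N N" "Mul a * B = 1\<^sub>m N"
    using obtain_inverse_mat[OF Mul_carrier, of a] by metis
  define b where "b = coeffs_poly (B *\<^sub>v cv 1)"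
  have c: "B *\<^sub>v cv 1 \<in> carrier_vec N" using B by simp
  have bN: "degree b < N" unfolding b_def by (rule degree_coeffs_poly[OF c N_pos])
  have "cv ((a * b) mod f) = Mul a *\<^sub>v cv b" using bN by (simp add: Mul_cv)
  also have "\<dots> = Mul a *\<^sub>v (B *\<^sub>v cv 1)" using c by (simp add: b_def)
  also have "\<dots> = (Mul a * B) *\<^sub>v cv 1"
    by (rule assoc_mult_mat_vec[symmetric, of _ N N _ N]) (use B in auto)
  also have "\<dots> = cv 1" by (simp add: B(2))
  finally have "(a * b) mod f = 1" by (rule vec_of_poly_inj[rotated 2]) (use N_pos in auto)
  then show "a \<in> Lunits f" using a bN by (auto simp: Lunits_def Lset_iff)
qed

lemma form_alpha_mod:
  "form_alpha f (a mod f) l m = form_alpha f a l m"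
  "form_alpha f a (l mod f) m = form_alpha f a l m"
  "form_alpha f a l (m mod f) = form_alpha f a l m"
  unfolding form_alpha_def by (metis mod_mult_left_eq mod_mult_right_eq mult.assoc)+

lemma form_alpha_mult: "form_alpha f a (b * l) m = form_alpha f (a * b) l m"
  "form_alpha f a l (b * m) = form_alpha f (a * b) l m"
  by (simp_all add: form_alpha_def ac_simps)

lemma form_alpha_commute: "form_alpha f a l m = form_alpha f a m l"
  by (simp add: form_alpha_def ac_simps)

lemma form_alpha_expand:
  assumes "degree m < N"
  shows "form_alpha f a l m = (\<Sum>j<N. coeff m j * form_alpha f a l (monom 1 j))"
  unfolding form_alpha_def mod_mult_expand[OF assms] by (simp add: coeff_sum)

lemma Gram_cv:
  assumes l: "degree l < N" and m: "degree m < N"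
  shows "cv l \<bullet> (Gram a *\<^sub>v cv m) = form_alpha f a l m"
proof -
  have row: "(Gram a *\<^sub>v cv m) $ i = form_alpha f a (monom 1 i) m" if "i < N" for i
  proof -
    have "(Gram a *\<^sub>v cv m) $ i = (\<Sum>j<N. coeff m j * row (Gram a) i $ j)"
      using that row_carrier[of "Gram a" i] by (simp add: scalar_prod_vec_of_poly)
    also have "\<dots> = (\<Sum>j<N. coeff m j * form_alpha f a (monom 1 i) (monom 1 j))"
      using that by (intro sum.cong) (auto simp: Gram_def)
    finally show ?thesis using form_alpha_expand[OF m] by simp
  qed
  have "cv l \<bullet> (Gram a *\<^sub>v cv m) = (\<Sum>i<N. coeff l i * (Gram a *\<^sub>v cv m) $ i)"
    using Gram_carrier[of a] by (simp add: scalar_prod_def lessThan_atLeast0)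
  also have "\<dots> = (\<Sum>i<N. coeff l i * form_alpha f a m (monom 1 i))"
    by (intro sum.cong refl) (simp add: row form_alpha_commute[of a m] del: index_mult_mat_vec)
  also have "\<dots> = form_alpha f a l m"
    using form_alpha_expand[OF l] by (simp add: form_alpha_commute[of a l m])
  finally show ?thesis .
qed

lemma eq_mat_poly_bilinearI:
  assumes A: "A \<in> carrier_mat N N" and B: "B \<in> carrier_mat N N"
    and eq: "\<And>l m. degree l < N \<Longrightarrow> degree m < N \<Longrightarrow> cv l \<bullet> (A *\<^sub>v cv m) = cv l \<bullet> (B *\<^sub>v (cv m :: 'k vec))"
  shows "A = B"
proof (rule eq_mat_bilinearI[OF A B])
  fix v w :: "'k vec" assume "v \<in> carrier_vec N" "w \<in> carrier_vec N"
  then show "v \<bullet> (A *\<^sub>v w) = v \<bullet> (B *\<^sub>v w)"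
    using eq[OF degree_coeffs_poly degree_coeffs_poly, of v w] N_pos by simp
qed

text \<open>A factor of an argument can be moved into the index of the form, because all three enter
  through one product. For a = 1 every Gram matrix is the fixed \<open>Gram 1\<close> times a
  multiplication matrix, so Gram determinants are norms up to one constant.\<close>

lemma Gram_mult: "Gram a * Mul b = Gram (a * b)"
proof (rule eq_mat_poly_bilinearI)
  fix l m :: "'k poly" assume lm: "degree l < N" "degree m < N"
  have "(Gram a * Mul b) *\<^sub>v cv m = Gram a *\<^sub>v (Mul b *\<^sub>v cv m)"
    by (rule assoc_mult_mat_vec[of _ N N _ N]) auto
  then have "cv l \<bullet> ((Gram a * Mul b) *\<^sub>v cv m) = form_alpha f a l ((b * m) mod f)"
    using lm by (simp add: Mul_cv Gram_cv)
  also have "\<dots> = form_alpha f (a * b) l m" by (simp add: form_alpha_mod form_alpha_mult)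
  finally show "cv l \<bullet> ((Gram a * Mul b) *\<^sub>v cv m) = cv l \<bullet> (Gram (a * b) *\<^sub>v cv m)"
    using lm by (simp add: Gram_cv)
qed (auto intro: mult_carrier_mat)

lemma Gram_transpose: "(Gram a)\<^sup>T = Gram a"
  by (intro eq_matI) (auto simp: Gram_def form_alpha_commute)

text \<open>Together with \<open>Gram_mult\<close> this says that multiplication by b is
  self-adjoint for every trace form.\<close>

lemma Mul_transpose_Gram: "(Mul b)\<^sup>T * Gram a = Gram (a * b)"
  by (metis Gram_mult Gram_transpose transpose_mult Gram_carrier Mul_carrier)

text \<open>Pairing p with the monomial that lifts its degree to exactly N - 1 involves no reduction
  modulo f and returns the leading coefficient of p.\<close>

lemma form_alpha_1_nondegenerate:
  assumes p: "degree p < N" and 0: "\<And>q. degree q < N \<Longrightarrow> form_alpha f 1 p q = 0"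
  shows "p = 0"
proof (rule ccontr)
  assume "p \<noteq> 0"
  let ?q = "monom (1 :: 'k) (N - 1 - degree p)"
  have d: "degree (p * ?q) = N - 1" using \<open>p \<noteq> 0\<close> p by (simp add: degree_mult_eq degree_monom_eq)
  then have "coeff (p * ?q) (N - 1) = lead_coeff p * 1"
    by (metis lead_coeff_mult lead_coeff_monom)
  moreover have "(p * ?q) mod f = p * ?q" using d N_pos by (intro mod_id) simp
  ultimately have "form_alpha f 1 p ?q = lead_coeff p" by (simp add: form_alpha_def deg)
  moreover have "degree ?q < N" using N_pos by (simp add: degree_monom_eq)
  ultimately show False using 0 \<open>p \<noteq> 0\<close> by auto
qed

lemma det_Gram_1: "det (Gram 1) \<noteq> 0"
proof
  assume "det (Gram 1) = 0"
  then obtain v where v: "v \<in> carrier_vec N" "v \<noteq> 0\<^sub>v N" "Gram 1 *\<^sub>v v = 0\<^sub>v N"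
    using det_0_iff_vec_prod_zero_field[OF Gram_carrier] by blast
  let ?p = "coeffs_poly v"
  have p: "degree ?p < N" by (rule degree_coeffs_poly[OF v(1) N_pos])
  have "?p = 0"
  proof (rule form_alpha_1_nondegenerate[OF p])
    fix q :: "'k poly" assume q: "degree q < N"
    have "form_alpha f 1 ?p q = cv q \<bullet> (Gram 1 *\<^sub>v cv ?p)"
      using p q by (simp add: Gram_cv form_alpha_commute)
    then show "form_alpha f 1 ?p q = 0" using v by simp
  qed
  then have "cv ?p = 0\<^sub>v N" by (intro eq_vecI) auto
  then show False using v by simp
qed

lemma det_Gram: "det (Gram a) = det (Gram 1) * det (Mul a)"
  using det_mult[OF Gram_carrier Mul_carrier, of 1 a] by (simp add: Gram_mult)

lemma Gram_inj:
  assumes "Gram a = Gram b"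
  shows "a mod f = b mod f"
proof -
  obtain B where B: "B \<in> carrier_mat N N" "B * Gram 1 = 1\<^sub>m N"
    using obtain_inverse_mat[OF Gram_carrier det_Gram_1] by metis
  have "Mul c = B * Gram c" for c
  proof -
    have "B * (Gram 1 * Mul c) = B * Gram 1 * Mul c"
      by (rule assoc_mult_mat[symmetric, OF B(1) Gram_carrier Mul_carrier])
    then show ?thesis by (simp add: Gram_mult B(2) left_mult_one_mat[OF Mul_carrier])
  qed
  then show ?thesis using assms by (intro Mul_inj) metis
qed

text \<open>The form for 1 is nondegenerate, so every functional on L is pairing with some a under
  it, which equals pairing with 1 under the form for a. This produces the \<alpha> of an
  operator.\<close>

lemma functional_representation:
  fixes \<phi> :: "nat \<Rightarrow> 'k"
  obtains a where "degree a < N" "\<And>i. i < N \<Longrightarrow> form_alpha f a (monom 1 i) 1 = \<phi> i"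
proof -
  obtain B where B: "B \<in> carrier_mat N N" "Gram 1 * B = 1\<^sub>m N"
    using obtain_inverse_mat[OF Gram_carrier det_Gram_1] by metis
  define v where "v = B *\<^sub>v vec N \<phi>"
  have v: "v \<in> carrier_vec N" using B by (simp add: v_def)
  define a where "a = coeffs_poly v"
  have a: "degree a < N" unfolding a_def by (rule degree_coeffs_poly[OF v N_pos])
  have "Gram 1 *\<^sub>v cv a = (Gram 1 * B) *\<^sub>v vec N \<phi>"
    using v unfolding a_def by (simp add: v_def assoc_mult_mat_vec[OF Gram_carrier B(1)])
  then have g: "Gram 1 *\<^sub>v cv a = vec N \<phi>" by (simp add: B(2))
  have "form_alpha f a (monom 1 i) 1 = \<phi> i" if i: "i < N" for i
  proof -
    have "form_alpha f a (monom 1 i) 1 = form_alpha f 1 (monom 1 i) a"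
      by (simp add: form_alpha_def ac_simps)
    also have "\<dots> = cv (monom 1 i) \<bullet> (Gram 1 *\<^sub>v cv a)"
      using i a by (simp add: Gram_cv degree_monom_eq)
    also have "\<dots> = \<phi> i" using i by (simp add: g unit_vec_of_poly scalar_prod_left_unit[of _ N])
    finally show ?thesis .
  qed
  with that a show thesis by blast
qed

abbreviation "Comp \<equiv> Mul (monom 1 1)"

text \<open>The row \<open>(1, x, \<dots>, x\<^sup>N\<^sup>-\<^sup>1)\<close> times \<open>xI - Comp\<close> vanishes modulo \<open>f\<close>, so multiplying by the adjugate
  gives \<open>f dvd char_poly Comp\<close>; both are monic of degree \<open>N\<close>.\<close>

lemma char_poly_Comp: "char_poly Comp = f"
proof -
  let ?A = "char_poly_matrix Comp"
  have A: "?A \<in> carrier_mat N N" by simp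
  note Q = adj_mat(1)[OF A]
  let ?r = "vec N (\<lambda>i. monom 1 i) :: 'k poly vec"
  have col: "f dvd (?A\<^sup>T *\<^sub>v ?r) $ j" if j: "j < N" for j
  proof -
    let ?c = "(monom 1 1 * monom 1 j) mod f :: 'k poly"
    have "(?A\<^sup>T *\<^sub>v ?r) $ j = (\<Sum>i<N. ?A $$ (i, j) * monom 1 i)"
      using j carrier_matD[OF A] by (simp add: scalar_prod_def lessThan_atLeast0)
    also have "\<dots> = (\<Sum>i<N. (if i = j then monom 1 1 * monom 1 i else 0) - Polynomial.smult (coeff ?c i) (monom 1 i))"
      using j by (intro sum.cong)
        (auto simp: char_poly_matrix_def Mul_def mult_monom monom_Suc)
    also have "\<dots> = monom 1 1 * monom 1 j - ?c"
      using j by (simp add: sum_subtractf poly_as_sum_lessThan)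
    also have "f dvd \<dots>" by (simp add: mod_eq_dvd_iff[symmetric])
    finally show ?thesis .
  qed
  have "((adj_mat ?A)\<^sup>T *\<^sub>v (?A\<^sup>T *\<^sub>v ?r)) = (?A * adj_mat ?A)\<^sup>T *\<^sub>v ?r"
    unfolding transpose_mult[OF A Q]
    by (rule assoc_mult_mat_vec[symmetric, of _ N N _ N]) (use A Q in auto)
  also have "\<dots> = det ?A \<cdot>\<^sub>v ?r"
    unfolding adj_mat(2)[OF A] by (intro eq_vecI) (auto simp: scalar_prod_def if_distrib if_distribR cong: if_cong)
  \<comment> \<open>Entry 0 of the row of monomials is 1, so comparing entries 0 isolates the
    determinant.\<close>
  finally have "det ?A = ((adj_mat ?A)\<^sup>T *\<^sub>v (?A\<^sup>T *\<^sub>v ?r)) $ 0"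
    using N_pos by simp
  also have "\<dots> = (\<Sum>j<N. (adj_mat ?A) $$ (j, 0) * (?A\<^sup>T *\<^sub>v ?r) $ j)"
    using N_pos carrier_matD[OF A] carrier_matD[OF Q] by (simp add: scalar_prod_def lessThan_atLeast0)
  also have "f dvd \<dots>" using col by (intro dvd_sum dvd_mult) auto
  finally have "f dvd char_poly Comp" by (simp add: char_poly_def)
  then obtain g where g: "char_poly Comp = f * g" by blast
  have c: "degree (char_poly Comp) = N" "lead_coeff (char_poly Comp) = 1"
    using degree_monic_char_poly[of Comp N] by auto
  then have g0: "g \<noteq> 0" using g by auto
  then have "degree g = 0" using c(1) g f_nz by (simp add: degree_mult_eq deg)
  moreover have "lead_coeff g = 1" using c(2) monic unfolding g by (simp add: lead_coeff_mult)
  ultimately have "g = 1" by (metis degree_0_id one_pCons of_nat_1 degree_eq_zeroE coeff_pCons_0)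
  then show ?thesis using g by simp
qed

end


section \<open>Hyperbolic bases\<close>

text \<open>Induction in the manner of Gram-Schmidt: the new vector minus its expansion in the
  earlier ones is nonzero by independence, and a coordinate where it does not vanish yields the new
  dual vector. The earlier dual vectors are then corrected to vanish on the new vector.\<close>

lemma dual_family:
  fixes w :: "nat \<Rightarrow> nat \<Rightarrow> 'a::field"
  assumes "\<And>c. \<forall>r<N. (\<Sum>i<m. c i * w i r) = 0 \<Longrightarrow> \<forall>i<m. c i = 0"
  shows "\<exists>z. \<forall>i<m. \<forall>j<m. (\<Sum>r<N. z i r * w j r) = (if i = j then 1 else 0)"
  using assms
proof (induction m)
  case 0
  then show ?case by simp
next
  case (Suc m)
  define ip where "ip x y = (\<Sum>r<N. x r * y r)" for x y :: "nat \<Rightarrow> 'a"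
  have ip_diff: "ip (\<lambda>r. x r - y r) u = ip x u - ip y u" for x y u
    by (simp add: ip_def left_diff_distrib sum_subtractf)
  have ip_smult: "ip (\<lambda>r. c * x r) u = c * ip x u" for c x u
    by (simp add: ip_def sum_distrib_left mult.assoc)
  have ip_sum: "ip (\<lambda>r. \<Sum>j<m. c j * z j r) u = (\<Sum>j<m. c j * ip (z j) u)" for c z u
    unfolding ip_def sum_distrib_right sum_distrib_left by (subst sum.swap) (simp add: mult.assoc)
  have "\<forall>i<m. c i = 0" if "\<forall>r<N. (\<Sum>i<m. c i * w i r) = 0" for c
  proof -
    \<comment> \<open>Independence is known for m + 1 vectors, so coefficients of the first m are
      padded by zero.\<close>
    have "(\<Sum>i<Suc m. (c(m := 0)) i * w i r) = (\<Sum>i<m. c i * w i r)" for r by simp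
    then have "\<forall>i<Suc m. (c(m := 0)) i = 0" using that by (intro Suc.prems) simp
    then show ?thesis by (auto simp: less_Suc_eq split: if_splits)
  qed
  then obtain z where z: "\<And>i j. i < m \<Longrightarrow> j < m \<Longrightarrow> ip (z i) (w j) = (if i = j then 1 else 0)"
    using Suc.IH unfolding ip_def by blast
  define w' where "w' r = w m r - (\<Sum>j<m. ip (z j) (w m) * w j r)" for r
  have "\<exists>r0<N. w' r0 \<noteq> 0"
  proof (rule ccontr)
    assume neg: "\<not> (\<exists>r0<N. w' r0 \<noteq> 0)"
    define c where "c i = (if i = m then 1 else - ip (z i) (w m))" for i
    have "(\<Sum>i<Suc m. c i * w i r) = w' r" for r
      by (simp add: c_def w'_def sum_negf)
    then have "\<forall>i<Suc m. c i = 0" using neg by (intro Suc.prems) simp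
    then show False by (auto simp: c_def)
  qed
  then obtain r0 where r0: "r0 < N" "w' r0 \<noteq> 0" by blast
  \<comment> \<open>The functional reading coordinate \<open>r0\<close>, scaled to take the value 1
    on \<open>w'\<close>.\<close>
  define z' where "z' r = (if r = r0 then 1 / w' r0 else 0)" for r
  have ip_z': "ip z' x = x r0 / w' r0" for x
    using r0 by (simp add: ip_def z'_def if_distrib[of "\<lambda>t. t * _"] cong: if_cong)
  \<comment> \<open>This is \<open>z'\<close> after the projection u - (sum of
    \<open>ip (z j) u\<close> times \<open>w j\<close>), which kills the earlier vectors and sends
    \<open>w m\<close> to \<open>w'\<close>.\<close>
  define zm where "zm r = z' r - (\<Sum>j<m. ip z' (w j) * z j r)" for r
  have ip_zm: "ip zm u = ip z' u - (\<Sum>j<m. ip z' (w j) * ip (z j) u)" for u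
    unfolding zm_def ip_diff ip_sum ..
  have zm_w: "ip zm (w j) = 0" if "j < m" for j
  proof -
    have "(\<Sum>i<m. ip z' (w i) * ip (z i) (w j)) = (\<Sum>i<m. if i = j then ip z' (w i) else 0)"
      using that by (intro sum.cong) (auto simp: z)
    then show ?thesis using that by (simp add: ip_zm)
  qed
  have zm_wm: "ip zm (w m) = 1"
  proof -
    have "(\<Sum>j<m. ip z' (w j) * ip (z j) (w m)) = (\<Sum>j<m. ip (z j) (w m) * w j r0) / w' r0"
      by (simp add: ip_z' sum_divide_distrib mult.commute)
    then have "ip zm (w m) = w' r0 / w' r0"
      by (simp add: ip_zm ip_z' diff_divide_distrib[symmetric]) (simp add: w'_def)
    then show ?thesis using r0 by simp
  qed
  define Z where "Z i = (if i = m then zm else (\<lambda>r. z i r - ip (z i) (w m) * zm r))" for i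
  have "ip (Z i) (w j) = (if i = j then 1 else 0)" if "i < Suc m" "j < Suc m" for i j
    using that by (auto simp: Z_def ip_diff ip_smult zm_w zm_wm z less_Suc_eq)
  then show ?case unfolding ip_def by blast
qed

lemma injective_mat_left_inverse:
  fixes W :: "'a::field mat"
  assumes W: "W \<in> carrier_mat N m"
    and inj: "\<And>c. c \<in> carrier_vec m \<Longrightarrow> W *\<^sub>v c = 0\<^sub>v N \<Longrightarrow> c = 0\<^sub>v m"
  obtains Z where "Z \<in> carrier_mat m N" "Z * W = 1\<^sub>m m"
proof -
  have "\<forall>i<m. c i = 0" if "\<forall>r<N. (\<Sum>i<m. c i * W $$ (r, i)) = 0" for c
  proof -
    have "W *\<^sub>v vec m c = 0\<^sub>v N"
      using W that by (intro eq_vecI) (auto simp: scalar_prod_def lessThan_atLeast0 mult.commute)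
    then have "vec m c = 0\<^sub>v m" using inj by simp
    then have "vec m c $ i = 0" if "i < m" for i using that by simp
    then show ?thesis by simp
  qed
  from dual_family[where N = N and m = m and w = "\<lambda>i r. W $$ (r, i)", OF this]
  obtain z where z: "\<And>i j. i < m \<Longrightarrow> j < m \<Longrightarrow> (\<Sum>r<N. z i r * W $$ (r, j)) = (if i = j then 1 else 0)"
    by blast
  show thesis
  proof (rule that[of "mat m N (\<lambda>(i, r). z i r)"])
    show "mat m N (\<lambda>(i, r). z i r) * W = 1\<^sub>m m"
      using W z by (intro eq_matI) (auto simp: scalar_prod_def lessThan_atLeast0)
  qed simp
qed

text \<open>Some X is dual to the isotropic W. Subtracting W times half the Gram matrix of X leaves
  the pairing with W unchanged, since W is isotropic, and cancels the Gram matrix of X: each of the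
  two cross terms removes one half.\<close>

lemma hyperbolic_complement:
  fixes G :: "'a::field mat"
  assumes two: "(2::'a) \<noteq> 0"
    and G: "G \<in> carrier_mat N N" and sym: "G\<^sup>T = G" and det: "det G \<noteq> 0"
    and W: "W \<in> carrier_mat N m" and iso: "W\<^sup>T * (G * W) = 0\<^sub>m m m"
    and inj: "\<And>c. c \<in> carrier_vec m \<Longrightarrow> W *\<^sub>v c = 0\<^sub>v N \<Longrightarrow> c = 0\<^sub>v m"
  obtains Y where "Y \<in> carrier_mat N m" "W\<^sup>T * (G * Y) = 1\<^sub>m m" "Y\<^sup>T * (G * W) = 1\<^sub>m m"
    "Y\<^sup>T * (G * Y) = 0\<^sub>m m m"
proof -
  obtain Z where Z: "Z \<in> carrier_mat m N" "Z * W = 1\<^sub>m m"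
    using injective_mat_left_inverse[OF W inj] .
  obtain G' where G': "G' \<in> carrier_mat N N" "G * G' = 1\<^sub>m N"
    using obtain_inverse_mat[OF G det] .
  have form_T: "(A\<^sup>T * (G * B))\<^sup>T = B\<^sup>T * (G * A)"
    if "A \<in> carrier_mat N m" "B \<in> carrier_mat N m" for A B
  proof -
    have "(A\<^sup>T * (G * B))\<^sup>T = (G * B)\<^sup>T * A"
      using transpose_mult[of "A\<^sup>T" m N "G * B" m] that G by simp
    also have "(G * B)\<^sup>T = B\<^sup>T * G" using transpose_mult[OF G that(2)] sym by simp
    also have "B\<^sup>T * G * A = B\<^sup>T * (G * A)"
      by (rule assoc_mult_mat[of _ m N _ N _ m]) (use that G in auto)
    finally show ?thesis .
  qed
  \<comment> \<open>X solves G X = \<open>Z\<^sup>T\<close>, so pairing W with X gives the transpose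
    of Z W = 1.\<close>
  define X where "X = G' * Z\<^sup>T"
  have X: "X \<in> carrier_mat N m" using G' Z by (simp add: X_def)
  have "G * X = (G * G') * Z\<^sup>T"
    unfolding X_def by (rule assoc_mult_mat[symmetric, of _ N N _ N _ m]) (use G G' Z in auto)
  then have "G * X = Z\<^sup>T" using G' Z by simp
  then have "W\<^sup>T * (G * X) = (Z * W)\<^sup>T" using transpose_mult[OF Z(1) W] by simp
  then have WX: "W\<^sup>T * (G * X) = 1\<^sub>m m" using Z(2) by simp
  have XW: "X\<^sup>T * (G * W) = 1\<^sub>m m" using form_T[OF W X] WX by simp
  define S where "S = X\<^sup>T * (G * X)"
  have GX: "G * X \<in> carrier_mat N m" and GW: "G * W \<in> carrier_mat N m" using G X W by auto
  have S: "S \<in> carrier_mat m m" unfolding S_def using X GX by simp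
  define V where "V = (1 / 2) \<cdot>\<^sub>m S"
  have V: "V \<in> carrier_mat m m" using S by (simp add: V_def)
  define Y where "Y = X - W * V"
  have Y: "Y \<in> carrier_mat N m" unfolding Y_def by (rule minus_carrier_mat) (use W V in auto)
  have form_Y: "A\<^sup>T * (G * Y) = A\<^sup>T * (G * X) - A\<^sup>T * (G * W) * V" if A: "A \<in> carrier_mat N m" for A
  proof -
    have "G * Y = G * X - G * (W * V)"
      unfolding Y_def by (rule mult_minus_distrib_mat[of _ N N _ m]) (use G X W V in auto)
    also have "G * (W * V) = G * W * V"
      by (rule assoc_mult_mat[symmetric, OF G W V])
    finally have "A\<^sup>T * (G * Y) = A\<^sup>T * (G * X) - A\<^sup>T * (G * W * V)"
      using mult_minus_distrib_mat[of "A\<^sup>T" m N "G * X" m "G * W * V"] A GX GW V by simp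
    also have "A\<^sup>T * (G * W * V) = A\<^sup>T * (G * W) * V"
      by (rule assoc_mult_mat[symmetric, of _ m N _ m _ m]) (use A GW V in auto)
    finally show ?thesis .
  qed
  have WY: "W\<^sup>T * (G * Y) = 1\<^sub>m m"
    unfolding form_Y[OF W] WX iso using V by (intro eq_matI) auto
  have XY: "X\<^sup>T * (G * Y) = V"
    unfolding form_Y[OF X] XW S_def[symmetric] left_mult_one_mat[OF V] V_def using S two
    by (intro eq_matI) (auto simp: field_simps)
  have YW: "Y\<^sup>T * (G * W) = 1\<^sub>m m" using form_T[OF W Y] WY by simp
  have "Y\<^sup>T * (G * X) = V\<^sup>T" using form_T[OF X Y] XY by simp
  moreover have "S\<^sup>T = S" unfolding S_def by (rule form_T[OF X X])
  moreover have "V\<^sup>T = (1 / 2) \<cdot>\<^sub>m S\<^sup>T" unfolding V_def by (intro eq_matI) auto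
  ultimately have YX: "Y\<^sup>T * (G * X) = V" by (simp add: V_def)
  have YY: "Y\<^sup>T * (G * Y) = 0\<^sub>m m m"
    unfolding form_Y[OF Y] YW YX using V by (intro eq_matI) auto
  show thesis by (rule that[OF Y WY YW YY])
qed

section \<open>The hyperbolic form and its Gram matrix\<close>

lemma sum_lessThan_add:
  fixes g :: "nat \<Rightarrow> 'a::comm_monoid_add"
  shows "(\<Sum>i<a + b. g i) = (\<Sum>i<a. g i) + (\<Sum>i<b. g (a + i))"
  by (induction b) (simp_all add: add.assoc)

text \<open>The Gram matrix of the polar form \<open>splitB\<close>: basis vectors i and i + m make
  a hyperbolic pair. The size is written m + m so that sums split into halves.\<close>

definition hyp_mat :: "nat \<Rightarrow> 'a::zero_neq_one mat" where
  "hyp_mat m = mat (m + m) (m + m) (\<lambda>(i, j). if j = i + m \<or> i = j + m then 1 else 0)"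

lemma hyp_mat_carrier [simp]: "hyp_mat m \<in> carrier_mat (m + m) (m + m)"
  and hyp_mat_dim [simp]: "dim_row (hyp_mat m) = m + m" "dim_col (hyp_mat m) = m + m"
  by (simp_all add: hyp_mat_def)

lemma hyp_mat_mult_vec:
  fixes v :: "'a::comm_ring_1 vec"
  assumes v: "v \<in> carrier_vec (m + m)" and i: "i < m + m"
  shows "(hyp_mat m *\<^sub>v v) $ i = v $ (if i < m then i + m else i - m)"
proof -
  let ?k = "if i < m then i + m else i - m"
  have "(hyp_mat m *\<^sub>v v) $ i = (\<Sum>j<m + m. (if j = ?k then v $ j else 0))"
  proof -
    have "(hyp_mat m *\<^sub>v v) $ i = (\<Sum>j<m + m. hyp_mat m $$ (i, j) * v $ j)"
      using v i by (simp add: scalar_prod_def lessThan_atLeast0)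
    also have "\<dots> = (\<Sum>j<m + m. (if j = ?k then v $ j else 0))"
      using i by (intro sum.cong) (auto simp: hyp_mat_def)
    finally show ?thesis .
  qed
  also have "\<dots> = v $ ?k" using i by (simp add: less_imp_diff_less)
  finally show ?thesis .
qed

lemma hyp_mat_transpose: "(hyp_mat m)\<^sup>T = hyp_mat m"
  by (intro eq_matI) (auto simp: hyp_mat_def)

text \<open>The matrix swaps the two halves of a vector, so its kernel is trivial.\<close>

lemma det_hyp_mat: "det (hyp_mat m :: 'a::field mat) \<noteq> 0"
proof
  let ?J = "hyp_mat m :: 'a mat"
  assume "det ?J = 0"
  then obtain v where v: "v \<in> carrier_vec (m + m)" "v \<noteq> 0\<^sub>v (m + m)" "?J *\<^sub>v v = 0\<^sub>v (m + m)"
    using det_0_iff_vec_prod_zero_field[OF hyp_mat_carrier] by blast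
  have "v $ i = 0" if "i < m + m" for i
    using hyp_mat_mult_vec[OF v(1), of "i + m"] hyp_mat_mult_vec[OF v(1), of "i - m"] v(3) that
      less_diff_conv2[of m i m]
    by (cases "i < m") auto
  then have "v = 0\<^sub>v (m + m)" using v(1) by (intro eq_vecI) auto
  then show False using v(2) by simp
qed

lemma splitB_eq:
  fixes v w :: "'a::field vec"
  assumes v: "v \<in> carrier_vec (Suc n + Suc n)" and w: "w \<in> carrier_vec (Suc n + Suc n)"
  shows "splitB n v w = v \<bullet> (hyp_mat (Suc n) *\<^sub>v w)"
proof -
  let ?m = "Suc n"
  have "v \<bullet> (hyp_mat ?m *\<^sub>v w) = (\<Sum>i<?m + ?m. v $ i * (hyp_mat ?m *\<^sub>v w) $ i)"
    by (simp add: scalar_prod_def lessThan_atLeast0)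
  also have "\<dots> = (\<Sum>i<?m + ?m. v $ i * w $ (if i < ?m then i + ?m else i - ?m))"
    by (intro sum.cong refl) (simp only: hyp_mat_mult_vec[OF w] lessThan_iff)
  also have "\<dots> = (\<Sum>i<?m. v $ i * w $ (?m + i)) + (\<Sum>i<?m. v $ (?m + i) * w $ i)"
    unfolding sum_lessThan_add by (intro arg_cong2[of _ _ _ _ "(+)"] sum.cong) (auto simp: add.commute)
  also have "\<dots> = splitB n v w"
  proof -
    have "splitQ n (v + w) = (\<Sum>i<?m. (v $ i + w $ i) * (v $ (?m + i) + w $ (?m + i)))"
      unfolding splitQ_def using v w by (intro sum.cong) auto
    then show ?thesis
      unfolding splitB_def splitQ_def by (simp only: sum.distrib[symmetric] sum_subtractf[symmetric])
        (intro sum.cong, auto simp: algebra_simps)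
  qed
  finally show ?thesis ..
qed

lemma splitB_self:
  "v \<in> carrier_vec (Suc n + Suc n) \<Longrightarrow> splitB n v v = 2 * splitQ n (v :: 'a::field vec)"
proof -
  assume v: "v \<in> carrier_vec (Suc n + Suc n)"
  have "splitQ n (v + v) = 4 * splitQ n v"
    unfolding splitQ_def sum_distrib_left using v by (intro sum.cong) auto
  then show ?thesis by (simp add: splitB_def)
qed

lemma index_transpose_mult_mult:
  fixes G :: "'a::comm_ring_1 mat"
  assumes "A \<in> carrier_mat N p" "G \<in> carrier_mat N N" "B \<in> carrier_mat N q" "i < p" "j < q"
  shows "(A\<^sup>T * (G * B)) $$ (i, j) = col A i \<bullet> (G *\<^sub>v col B j)"
proof -
  have "(A\<^sup>T * (G * B)) $$ (i, j) = row A\<^sup>T i \<bullet> col (G * B) j"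
    by (rule index_mult_mat(1)) (use assms in auto)
  also have "row A\<^sup>T i = col A i" by (rule row_transpose) (use assms in auto)
  also have "col (G * B) j = G *\<^sub>v col B j" by (rule col_mult2[OF assms(2,3,5)])
  finally show ?thesis .
qed

text \<open>The columns of H are those of W followed by those of an isotropic dual family Y, so the
  four blocks of the Gram matrix are 0, 1, 1, 0. This turns an isotropic subspace of half the
  dimension into an isometry with U.\<close>

lemma hyperbolic_basis:
  fixes G :: "'a::field mat"
  assumes two: "(2::'a) \<noteq> 0"
    and G: "G \<in> carrier_mat (m + m) (m + m)" and sym: "G\<^sup>T = G" and det: "det G \<noteq> 0"
    and W: "W \<in> carrier_mat (m + m) m" and iso: "W\<^sup>T * (G * W) = 0\<^sub>m m m"
    and inj: "\<And>c. c \<in> carrier_vec m \<Longrightarrow> W *\<^sub>v c = 0\<^sub>v (m + m) \<Longrightarrow> c = 0\<^sub>v m"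
  obtains H where "H \<in> carrier_mat (m + m) (m + m)" "H\<^sup>T * (G * H) = hyp_mat m"
proof -
  let ?N = "m + m"
  obtain Y where Y: "Y \<in> carrier_mat ?N m" and f: "W\<^sup>T * (G * Y) = 1\<^sub>m m" "Y\<^sup>T * (G * W) = 1\<^sub>m m"
    "Y\<^sup>T * (G * Y) = 0\<^sub>m m m"
    using hyperbolic_complement[OF two G sym det W iso inj] .
  define H where "H = mat ?N ?N (\<lambda>(i, j). if j < m then W $$ (i, j) else Y $$ (i, j - m))"
  have H: "H \<in> carrier_mat ?N ?N" by (simp add: H_def)
  have col: "col H j = (if j < m then col W j else col Y (j - m))" if "j < ?N" for j
    using that W Y by (intro eq_vecI) (auto simp: H_def)
  have e: "col A i \<bullet> (G *\<^sub>v col B j) = M $$ (i, j)"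
    if "A \<in> carrier_mat ?N m" "B \<in> carrier_mat ?N m" "A\<^sup>T * (G * B) = M" "i < m" "j < m" for A B M i j
    using index_transpose_mult_mult[OF that(1) G that(2) that(4,5)] that(3) by simp
  have "H\<^sup>T * (G * H) = hyp_mat m"
  proof (rule eq_matI)
    fix i j assume "i < dim_row (hyp_mat m :: 'a mat)" "j < dim_col (hyp_mat m :: 'a mat)"
    then have ij: "i < ?N" "j < ?N" by auto
    have "(H\<^sup>T * (G * H)) $$ (i, j) = col H i \<bullet> (G *\<^sub>v col H j)"
      by (rule index_transpose_mult_mult[OF H G H ij])
    also have "\<dots> = hyp_mat m $$ (i, j)"
      using ij e[OF W W iso, of i j] e[OF W Y f(1), of i "j - m"] e[OF Y W f(2), of "i - m" j]
        e[OF Y Y f(3), of "i - m" "j - m"]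
      by (auto simp: col hyp_mat_def)
    finally show "(H\<^sup>T * (G * H)) $$ (i, j) = hyp_mat m $$ (i, j)" .
  qed (use H in auto)
  with H show thesis by (rule that)
qed


section \<open>Isometries from the quotient algebra to the split space\<close>

text \<open>\<open>m\<close> is half the dimension, the size of the isotropic families in
  \<open>form_split\<close>; \<open>N\<close> is written m + m to match
  \<open>hyp_mat\<close>.\<close>

locale split_quotient = poly_quotient f N
  for f :: "'k::field poly" and N :: nat +
  fixes n m :: nat
  assumes m_eq: "m = Suc n" and N_eq: "N = m + m"
    and two: "(2::'k) \<noteq> 0" and sqf: "coprime f (pderiv f)"
begin

definition J :: "'k mat" where "J = hyp_mat m"

lemma J_carrier [simp]: "J \<in> carrier_mat N N"
  and J_dim [simp]: "dim_row J = N" "dim_col J = N"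
  and J_transpose: "J\<^sup>T = J"
  and det_J: "det J \<noteq> 0"
  by (simp_all add: J_def N_eq hyp_mat_transpose det_hyp_mat)

lemma splitB_J: "v \<in> carrier_vec N \<Longrightarrow> w \<in> carrier_vec N \<Longrightarrow> splitB n v w = v \<bullet> (J *\<^sub>v w)"
  unfolding J_def using splitB_eq[of v n w] by (simp add: N_eq m_eq)

lemma N_alt: "2 * n + 2 = N"
  by (simp add: N_eq m_eq)

lemma mult_mat_vec_carrier_N [simp]:
  "A \<in> carrier_mat N N \<Longrightarrow> v \<in> carrier_vec N \<Longrightarrow> A *\<^sub>v v \<in> carrier_vec N"
  by (rule mult_mat_vec_carrier)

lemma mult_carrier_N [simp]:
  "A \<in> carrier_mat N N \<Longrightarrow> B \<in> carrier_mat N N \<Longrightarrow> A * B \<in> carrier_mat N N"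
  by simp

lemma assoc_N:
  fixes A B D :: "'k mat"
  shows "A \<in> carrier_mat N N \<Longrightarrow> B \<in> carrier_mat N N \<Longrightarrow> D \<in> carrier_mat N N \<Longrightarrow> A * B * D = A * (B * D)"
  by (rule assoc_mult_mat)

text \<open>Once \<open>assoc_N\<close> has nested all products to the right, an inverse pair
  appears in this shape.\<close>

lemma cancel_inverse:
  fixes A B D :: "'k mat"
  assumes "A \<in> carrier_mat N N" "B \<in> carrier_mat N N" "A * B = 1\<^sub>m N" "D \<in> carrier_mat N N"
  shows "A * (B * D) = D"
  using assms assoc_N[of A B D] by simp

lemma transpose_mult_N:
  fixes A B :: "'k mat"
  shows "A \<in> carrier_mat N N \<Longrightarrow> B \<in> carrier_mat N N \<Longrightarrow> (A * B)\<^sup>T = B\<^sup>T * A\<^sup>T"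
  by (rule transpose_mult)

lemma form_mult_vec:
  fixes A B :: "'k mat"
  assumes "A \<in> carrier_mat N N" "B \<in> carrier_mat N N" "v \<in> carrier_vec N" "w \<in> carrier_vec N"
  shows "splitB n (A *\<^sub>v v) (B *\<^sub>v w) = v \<bullet> ((A\<^sup>T * (J * B)) *\<^sub>v w)"
proof -
  have "splitB n (A *\<^sub>v v) (B *\<^sub>v w) = v \<bullet> (A\<^sup>T *\<^sub>v (J *\<^sub>v (B *\<^sub>v w)))"
    using assms by (simp add: splitB_J scalar_prod_mult_transpose[of A N N])
  also have "J *\<^sub>v (B *\<^sub>v w) = (J * B) *\<^sub>v w"
    by (rule assoc_mult_mat_vec[symmetric, of _ N N _ N]) (use assms in auto)
  also have "A\<^sup>T *\<^sub>v ((J * B) *\<^sub>v w) = (A\<^sup>T * (J * B)) *\<^sub>v w"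
    by (rule assoc_mult_mat_vec[symmetric, of _ N N _ N]) (use assms in auto)
  finally show ?thesis .
qed

text \<open>Preserving Q implies preserving its polar form, whose matrix is \<open>J\<close>;
  conversely the polar form at (v, v) is 2 Q(v), and 2 can be cancelled. Invertibility follows from
  the nonzero determinant of \<open>J\<close>.\<close>

lemma orth_group_iff:
  assumes g: "g \<in> carrier_mat N N"
  shows "g \<in> orth_group n \<longleftrightarrow> g\<^sup>T * (J * g) = J"
proof
  assume "g \<in> orth_group n"
  then have Q: "splitQ n (g *\<^sub>v v) = splitQ n v" if "v \<in> carrier_vec N" for v
    using that unfolding orth_group_def N_alt by simp
  show "g\<^sup>T * (J * g) = J"
  proof (rule eq_mat_bilinearI[of _ N])
    fix v w :: "'k vec" assume v: "v \<in> carrier_vec N" and w: "w \<in> carrier_vec N"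
    have "v \<bullet> ((g\<^sup>T * (J * g)) *\<^sub>v w) = splitB n (g *\<^sub>v v) (g *\<^sub>v w)"
      using form_mult_vec[OF g g v w] by simp
    also have "g *\<^sub>v v + g *\<^sub>v w = g *\<^sub>v (v + w)"
      using mult_add_distrib_mat_vec[OF g v w] by simp
    then have "splitB n (g *\<^sub>v v) (g *\<^sub>v w) = splitB n v w"
      using v w by (simp add: splitB_def Q)
    also have "\<dots> = v \<bullet> (J *\<^sub>v w)" by (rule splitB_J[OF v w])
    finally show "v \<bullet> ((g\<^sup>T * (J * g)) *\<^sub>v w) = v \<bullet> (J *\<^sub>v w)" .
  qed (use g in auto)
next
  assume eq: "g\<^sup>T * (J * g) = J"
  have "splitQ n (g *\<^sub>v v) = splitQ n v" if v: "v \<in> carrier_vec N" for v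
  proof -
    have "2 * splitQ n (g *\<^sub>v v) = splitB n (g *\<^sub>v v) (g *\<^sub>v v)"
      using v g by (simp add: splitB_self N_eq m_eq)
    also have "\<dots> = splitB n v v"
      using form_mult_vec[OF g g v v] eq splitB_J[OF v v] by simp
    also have "\<dots> = 2 * splitQ n v" using v by (simp add: splitB_self N_eq m_eq)
    finally show ?thesis using two by simp
  qed
  moreover have "invertible_mat g"
  proof -
    have "det (g\<^sup>T * (J * g)) = det g * (det J * det g)"
      using g by (simp add: det_mult[of _ N] det_transpose)
    then have "det g \<noteq> 0" using eq det_J by auto
    then obtain h where "h \<in> carrier_mat N N" "g * h = 1\<^sub>m N" "h * g = 1\<^sub>m N"
      using obtain_inverse_mat[OF g] by metis
    then show ?thesis using g unfolding invertible_mat_def inverts_mat_def by auto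
  qed
  ultimately show "g \<in> orth_group n" using g unfolding orth_group_def N_alt by simp
qed

lemma Vf_iff: "T \<in> Vf n f \<longleftrightarrow> T \<in> carrier_mat N N \<and> T\<^sup>T * J = J * T \<and> char_poly T = f"
proof -
  have "(\<forall>v \<in> carrier_vec N. \<forall>w \<in> carrier_vec N. splitB n (T *\<^sub>v v) w = splitB n v (T *\<^sub>v w))
      \<longleftrightarrow> T\<^sup>T * J = J * T" if T: "T \<in> carrier_mat N N"
  proof -
    have l: "splitB n (T *\<^sub>v v) w = v \<bullet> ((T\<^sup>T * J) *\<^sub>v w)"
      and r: "splitB n v (T *\<^sub>v w) = v \<bullet> ((J * T) *\<^sub>v w)"
      if "v \<in> carrier_vec N" "w \<in> carrier_vec N" for v w
      using form_mult_vec[OF T one_carrier_mat that] form_mult_vec[OF one_carrier_mat T that]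
        that right_mult_one_mat[OF J_carrier] left_mult_one_mat[of "J * T" N N] T
      by simp_all
    show ?thesis
    proof
      assume a: "\<forall>v \<in> carrier_vec N. \<forall>w \<in> carrier_vec N. splitB n (T *\<^sub>v v) w = splitB n v (T *\<^sub>v w)"
      show "T\<^sup>T * J = J * T"
        by (rule eq_mat_bilinearI[of _ N]) (use T a l r in auto)
    qed (simp add: l r)
  qed
  then show ?thesis unfolding Vf_def N_alt by auto
qed

text \<open>\<open>P\<close> is the matrix of an isometry from \<open>L\<close> with the form \<open>\<langle>,\<rangle>\<^sub>a\<close> to \<open>U\<close> that carries
  multiplication by \<open>\<beta>\<close> to \<open>T\<close>.\<close>

definition realizes :: "'k mat \<Rightarrow> 'k poly \<Rightarrow> 'k mat \<Rightarrow> bool" where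
  "realizes P a T \<longleftrightarrow> P \<in> carrier_mat N N \<and> det P \<noteq> 0 \<and> T \<in> carrier_mat N N \<and>
     T * P = P * Comp \<and> P\<^sup>T * (J * P) = Gram a"

lemma realizesD:
  assumes "realizes P a T"
  shows "P \<in> carrier_mat N N" "det P \<noteq> 0" "T \<in> carrier_mat N N" "T * P = P * Comp"
    "P\<^sup>T * (J * P) = Gram a"
  using assms by (auto simp: realizes_def)

text \<open>Multiplication by l commutes with multiplication by \<beta>, so the operator is
  unchanged, while l enters both arguments of the form.\<close>

lemma realizes_mult:
  assumes R: "realizes P a T" and l: "det (Mul l) \<noteq> 0"
  shows "realizes (P * Mul l) (a * l * l) T"
proof -
  note P = realizesD[OF R]
  have "T * (P * Mul l) = (T * P) * Mul l" using P(1,3) by (simp add: assoc_N)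
  also have "\<dots> = P * (Comp * Mul l)" unfolding P(4) using P(1) by (simp add: assoc_N)
  also have "Comp * Mul l = Mul l * Comp" by (simp add: Mul_mult mult.commute)
  finally have 1: "T * (P * Mul l) = P * Mul l * Comp" using P(1,3) by (simp add: assoc_N)
  have "(P * Mul l)\<^sup>T * (J * (P * Mul l)) = (Mul l)\<^sup>T * ((P\<^sup>T * (J * P)) * Mul l)"
    using P(1,3) by (simp add: assoc_N transpose_mult_N)
  also have "\<dots> = Gram (a * l * l)"
    unfolding P(5) Gram_mult Mul_transpose_Gram by (simp add: ac_simps)
  finally show ?thesis using P l 1 by (simp add: realizes_def det_mult[of _ N])
qed

text \<open>A map commuting with \<beta> is L-linear, hence multiplication by its value at 1; this
  is verified on the powers of \<beta>.\<close>

lemma commute_Comp_imp_Mul: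
  assumes D: "D \<in> carrier_mat N N" and c: "Comp * D = D * Comp"
  obtains l where "degree l < N" "D = Mul l"
proof -
  define l where "l = coeffs_poly (D *\<^sub>v cv 1)"
  have D1: "D *\<^sub>v cv 1 \<in> carrier_vec N" using D by simp
  have l: "degree l < N" "cv l = D *\<^sub>v cv 1"
    using degree_coeffs_poly[OF D1 N_pos] vec_of_coeffs_poly[OF D1] by (simp_all add: l_def)
  have monom: "D *\<^sub>v cv (monom 1 i) = Mul l *\<^sub>v cv (monom 1 i)" if "i < N" for i
    using that
  proof (induction i)
    case 0
    then show ?case using l N_pos by (simp add: Mul_cv mod_id)
  next
    case (Suc i)
    have "cv (monom 1 (Suc i)) = Comp *\<^sub>v cv (monom 1 i)"
      using Suc.prems by (simp add: Mul_cv degree_monom_eq mult_monom mod_id)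
    moreover have "D *\<^sub>v (Comp *\<^sub>v cv (monom 1 i)) = (D * Comp) *\<^sub>v cv (monom 1 i)"
      by (rule assoc_mult_mat_vec[symmetric, of _ N N _ N]) (use D in auto)
    moreover have "\<dots> = Comp *\<^sub>v (D *\<^sub>v cv (monom 1 i))"
      unfolding c[symmetric] by (rule assoc_mult_mat_vec[of _ N N _ N]) (use D in auto)
    moreover have "\<dots> = (Comp * Mul l) *\<^sub>v cv (monom 1 i)"
      using Suc by (simp add: assoc_mult_mat_vec[of _ N N _ N])
    moreover have "\<dots> = (Mul l * Comp) *\<^sub>v cv (monom 1 i)"
      by (simp add: Mul_mult mult.commute)
    moreover have "\<dots> = Mul l *\<^sub>v (Comp *\<^sub>v cv (monom 1 i))"
      by (rule assoc_mult_mat_vec[of _ N N _ N]) auto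
    ultimately show ?case by metis
  qed
  have "D = Mul l"
  proof (rule eq_matI)
    fix i j assume ij: "i < dim_row (Mul l)" "j < dim_col (Mul l)"
    have "(D *\<^sub>v unit_vec N j) $ i = (Mul l *\<^sub>v unit_vec N j) $ i"
      using monom[of j] ij by (simp add: unit_vec_of_poly)
    then show "D $$ (i, j) = Mul l $$ (i, j)" using D ij by (simp add: scalar_prod_right_unit)
  qed (use D in auto)
  with l that show thesis by blast
qed

text \<open>Given g, both g P and P' carry multiplication by \<beta> to T', and comparing their Gram
  matrices yields l. Given l, the matrices P \<open>Mul l\<close> and P' have equal Gram matrices,
  so the change from one to the other is orthogonal and carries T to T'.\<close>

lemma conj_iff_sq:
  assumes R: "realizes P a T" and R': "realizes P' a' T'"
    and a: "a \<in> Lunits f" and a': "a' \<in> Lunits f"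
  shows "(\<exists>g \<in> orth_group n. T' * g = g * T) \<longleftrightarrow> (\<exists>l \<in> Lunits f. a' = (a * l * l) mod f)"
proof
  note P = realizesD[OF R] and P' = realizesD[OF R']
  obtain Q where Q: "Q \<in> carrier_mat N N" "P * Q = 1\<^sub>m N" "Q * P = 1\<^sub>m N"
    using obtain_inverse_mat[OF P(1,2)] .
  {
    assume "\<exists>g \<in> orth_group n. T' * g = g * T"
    then obtain g where g: "g \<in> orth_group n" and conj: "T' * g = g * T" by blast
    have gc: "g \<in> carrier_mat N N" using g unfolding orth_group_def N_alt by simp
    have gJ: "g\<^sup>T * (J * g) = J" using g orth_group_iff[OF gc] by simp
    obtain g' where g': "g' \<in> carrier_mat N N" "g * g' = 1\<^sub>m N" "g' * g = 1\<^sub>m N"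
    proof (rule obtain_inverse_mat[OF gc])
      have "det (g\<^sup>T * (J * g)) = det g * (det J * det g)"
        using gc by (simp add: det_mult[of _ N] det_transpose)
      then show "det g \<noteq> 0" using gJ det_J by auto
    qed
    \<comment> \<open>D is chosen so that g P D = P'.\<close>
    define D where "D = Q * (g' * P')"
    have D: "D \<in> carrier_mat N N" using Q g' P'(1,3) by (simp add: D_def)
    have gPD: "g * (P * D) = P'"
      unfolding D_def using cancel_inverse[OF P(1) Q(1,2)] cancel_inverse[OF gc g'(1,2)] P' g' by simp
    have "g * (P * (Comp * D)) = g * ((P * Comp) * D)" using P(1,3) D by (simp add: assoc_N)
    also have "\<dots> = (g * T) * (P * D)" unfolding P(4)[symmetric] using P(1,3) D gc by (simp add: assoc_N)
    also have "\<dots> = T' * (g * (P * D))" using P(1,3) P'(1,3) D gc by (simp add: conj[symmetric] assoc_N)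
    also have "\<dots> = P' * Comp" by (simp only: gPD P'(4))
    also have "\<dots> = g * (P * (D * Comp))" using P(1,3) D gc by (simp add: gPD[symmetric] assoc_N)
    finally have "Q * (g' * (g * (P * (Comp * D)))) = Q * (g' * (g * (P * (D * Comp))))" by simp
    then have "Comp * D = D * Comp"
      using cancel_inverse[OF g'(1) gc g'(3)] cancel_inverse[OF Q(1) P(1) Q(3)] P D by simp
    then obtain l where l: "degree l < N" "D = Mul l" using commute_Comp_imp_Mul[OF D] by blast
    have "det P' = det g * (det P * det D)"
      unfolding gPD[symmetric] using gc P(1,3) D by (simp add: det_mult[of _ N])
    then have lu: "l \<in> Lunits f" using P'(2) l by (auto simp: Lunits_iff)
    have "Gram a' = P'\<^sup>T * (J * P')" by (simp only: P'(5))
    also have "\<dots> = D\<^sup>T * (P\<^sup>T * ((g\<^sup>T * (J * g)) * (P * D)))"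
      unfolding gPD[symmetric] using gc P(1,3) D by (simp add: assoc_N transpose_mult_N)
    also have "\<dots> = D\<^sup>T * ((P\<^sup>T * (J * P)) * D)"
      unfolding gJ using P(1,3) D by (simp add: assoc_N)
    also have "\<dots> = Gram (a * l * l)"
      unfolding P(5) l(2) Gram_mult Mul_transpose_Gram by (simp add: ac_simps)
    finally have "a' mod f = (a * l * l) mod f" by (rule Gram_inj)
    then show "\<exists>l \<in> Lunits f. a' = (a * l * l) mod f"
      using lu a' by (auto simp: Lunits_iff mod_id)
  }
  {
    assume "\<exists>l \<in> Lunits f. a' = (a * l * l) mod f"
    then obtain l where l: "l \<in> Lunits f" and a'_eq: "a' = (a * l * l) mod f" by blast
    define X where "X = P * Mul l"
    have RX: "realizes X (a * l * l) T"
      unfolding X_def by (rule realizes_mult[OF R]) (use l in \<open>simp add: Lunits_iff\<close>)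
    note X = realizesD[OF RX]
    have "Gram a' = Gram (a * l * l)"
      unfolding a'_eq by (simp add: Gram_def form_alpha_mod)
    then have XP': "X\<^sup>T * (J * X) = P'\<^sup>T * (J * P')" by (simp only: X(5) P'(5) \<open>Gram a' = Gram (a * l * l)\<close>)
    obtain Y where Y: "Y \<in> carrier_mat N N" "X * Y = 1\<^sub>m N" "Y * X = 1\<^sub>m N"
      using obtain_inverse_mat[OF X(1,2)] .
    define g where "g = P' * Y"
    have gc: "g \<in> carrier_mat N N" using P'(1,3) Y by (simp add: g_def)
    have "Y\<^sup>T * X\<^sup>T = 1\<^sub>m N" using transpose_mult_N[OF X(1) Y(1)] Y(2) by simp
    note cYX = cancel_inverse[OF _ _ this]
    have "g\<^sup>T * (J * g) = Y\<^sup>T * ((P'\<^sup>T * (J * P')) * Y)"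
      unfolding g_def using P'(1,3) Y by (simp add: assoc_N transpose_mult_N)
    also have "\<dots> = Y\<^sup>T * (X\<^sup>T * (J * (X * Y)))"
      unfolding XP'[symmetric] using X(1,3) Y by (simp add: assoc_N)
    also have "\<dots> = J" using X Y cYX by (simp add: right_mult_one_mat[OF J_carrier])
    finally have "g \<in> orth_group n" using orth_group_iff[OF gc] by simp
    moreover have "T' * g = g * T"
    proof -
      have "X * (Comp * Y) = (X * Comp) * Y" using X(1,3) Y by (simp add: assoc_N)
      also have "\<dots> = T * (X * Y)" unfolding X(4)[symmetric] using X(1,3) Y(1) by (simp add: assoc_N)
      also have "\<dots> = T" using X(3) Y(2) by simp
      finally have XCY: "X * (Comp * Y) = T" .
      have "T' * g = (T' * P') * Y" unfolding g_def using P'(1,3) Y(1) by (simp add: assoc_N)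
      also have "\<dots> = P' * (Comp * Y)" unfolding P'(4) using P'(1,3) Y(1) by (simp add: assoc_N)
      also have "\<dots> = P' * (Y * (X * (Comp * Y)))"
        using cancel_inverse[OF Y(1) X(1) Y(3)] Y by simp
      also have "\<dots> = g * T" unfolding XCY g_def using P'(1,3) Y X(1,3) by (simp add: assoc_N)
      finally show ?thesis .
    qed
    ultimately show "\<exists>g \<in> orth_group n. T' * g = g * T" by blast
  }
qed

text \<open>Self-adjointness of T makes the pulled-back form depend only on the product of its
  arguments. It is therefore determined by the functional obtained by pairing with 1, and that
  functional is represented by some a.\<close>

lemma exists_realizes:
  assumes "T \<in> Vf n f"
  shows "\<exists>a \<in> Lunits f. \<exists>P. realizes P a T"
proof -
  have T: "T \<in> carrier_mat N N" and sym: "T\<^sup>T * J = J * T" and cp: "char_poly T = f"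
    using assms by (auto simp: Vf_iff)
  obtain u where u: "u \<in> carrier_vec N" and ann: "\<And>p. pmat T p *\<^sub>v u = 0\<^sub>v N \<longleftrightarrow> f dvd p"
    using squarefree_char_poly_cyclic[OF T] sqf cp by metis
  note pc = pmat_carrier[OF T]
  \<comment> \<open>The columns are u, Tu, ..., T^(N-1) u for the cyclic vector u.\<close>
  define P where "P = mat N N (\<lambda>(i, j). (pmat T (monom 1 j) *\<^sub>v u) $ i)"
  have P: "P \<in> carrier_mat N N" by (simp add: P_def)
  have colP: "P *\<^sub>v unit_vec N j = pmat T (monom 1 j) *\<^sub>v u" if "j < N" for j
    using that P carrier_matD[OF pc] 
    by (intro eq_vecI) (auto simp: P_def scalar_prod_right_unit)
  have P_cv: "P *\<^sub>v cv p = pmat T p *\<^sub>v u" if "degree p < N" for p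
  proof -
    have smult_mult_vec: "(k \<cdot>\<^sub>m pmat T q) *\<^sub>v u = k \<cdot>\<^sub>v (pmat T q *\<^sub>v u)" for k q
      using u carrier_matD[OF pc] by (intro eq_vecI) (auto simp: scalar_prod_def sum_distrib_left mult.assoc)
    have lin: "pmat T (\<Sum>j\<in>A. Polynomial.smult (c j) (monom 1 j)) *\<^sub>v u
        = vec N (\<lambda>i. \<Sum>j\<in>A. c j * (pmat T (monom 1 j) *\<^sub>v u) $ i)" if "finite A" for A c
      using that
    proof (induction A)
      case empty
      then show ?case using T u by (intro eq_vecI) (auto simp: pmat_0)
    next
      case (insert x F)
      have "pmat T (\<Sum>j\<in>insert x F. Polynomial.smult (c j) (monom 1 j)) *\<^sub>v u
        = c x \<cdot>\<^sub>v (pmat T (monom 1 x) *\<^sub>v u) + pmat T (\<Sum>j\<in>F. Polynomial.smult (c j) (monom 1 j)) *\<^sub>v u"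
        using insert.hyps add_mult_distrib_mat_vec[OF smult_carrier_mat[OF pc] pc u]
          smult_mult_vec
        by (simp add: pmat_add[OF T] pmat_smult[OF T])
      then show ?case using insert carrier_matD[OF pc] by (intro eq_vecI) auto
    qed
    have "pmat T p *\<^sub>v u = vec N (\<lambda>i. \<Sum>j<N. coeff p j * (pmat T (monom 1 j) *\<^sub>v u) $ i)"
      using lin[of "{..<N}" "coeff p"] poly_as_sum_lessThan[OF that] by simp
    also have "\<dots> = P *\<^sub>v cv p"
      by (intro eq_vecI) (auto simp: P_def scalar_prod_def lessThan_atLeast0 mult.commute)
    finally show ?thesis by simp
  qed
  have P_mod: "pmat T (p mod f) *\<^sub>v u = pmat T p *\<^sub>v u" for p
  proof -
    have "p = p mod f + f * (p div f)" by simp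
    then have "pmat T p *\<^sub>v u = pmat T (p mod f) *\<^sub>v u + pmat T (f * (p div f)) *\<^sub>v u"
      using add_mult_distrib_mat_vec[OF pc pc u] pmat_add[OF T] by metis
    also have "pmat T (f * (p div f)) *\<^sub>v u = 0\<^sub>v N" using ann by simp
    finally show ?thesis using pc[of "p mod f"] u by simp
  qed
  have detP: "det P \<noteq> 0"
  proof
    assume "det P = 0"
    then obtain v where v: "v \<in> carrier_vec N" "v \<noteq> 0\<^sub>v N" "P *\<^sub>v v = 0\<^sub>v N"
      using det_0_iff_vec_prod_zero_field[OF P] by blast
    let ?p = "coeffs_poly v"
    have d: "degree ?p < N" by (rule degree_coeffs_poly[OF v(1) N_pos])
    have "pmat T ?p *\<^sub>v u = 0\<^sub>v N" using P_cv[OF d] v by simp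
    then have "f dvd ?p" using ann by simp
    then have "?p = 0" using d deg by (metis dvd_imp_degree_le not_le)
    then have "cv ?p = 0\<^sub>v N" by (intro eq_vecI) auto
    then show False using v by simp
  qed
  have TP: "T * P = P * Comp"
  proof (rule eq_mat_polyI[OF _ _ N_pos])
    fix p :: "'k poly" assume p: "degree p < N"
    have "(T * P) *\<^sub>v cv p = T *\<^sub>v (P *\<^sub>v cv p)"
      by (rule assoc_mult_mat_vec[OF T P]) simp
    also have "\<dots> = pmat T (monom 1 1) *\<^sub>v (pmat T p *\<^sub>v u)"
      by (simp only: P_cv[OF p] pmat_X[OF T])
    also have "\<dots> = pmat T ((monom 1 1 * p) mod f) *\<^sub>v u"
      by (simp only: P_mod pmat_mult_vec[OF T u])
    also have "\<dots> = P *\<^sub>v (Comp *\<^sub>v cv p)"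
      by (simp only: P_cv[OF mod_Lset] Mul_cv[OF p])
    also have "\<dots> = (P * Comp) *\<^sub>v cv p"
      by (rule assoc_mult_mat_vec[symmetric, OF P Mul_carrier]) simp
    finally show "(T * P) *\<^sub>v cv p = (P * Comp) *\<^sub>v cv p" .
  qed (use T P in auto)
  define G where "G = P\<^sup>T * (J * P)"
  have G: "G \<in> carrier_mat N N" using P by (simp add: G_def)
  have "Comp\<^sup>T * G = (P * Comp)\<^sup>T * (J * P)" using P by (simp add: G_def transpose_mult_N assoc_N)
  also have "\<dots> = P\<^sup>T * ((T\<^sup>T * J) * P)" unfolding TP[symmetric] using P T by (simp add: transpose_mult_N assoc_N)
  also have "\<dots> = P\<^sup>T * (J * (T * P))" using P T by (simp add: sym assoc_N)
  also have "\<dots> = G * Comp" using P by (simp add: TP G_def assoc_N)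
  finally have Gsym: "Comp\<^sup>T * G = G * Comp" .
  let ?B = "\<lambda>p q. cv p \<bullet> (G *\<^sub>v cv q)"
  have shift: "?B (monom 1 (Suc i)) q = ?B (monom 1 i) ((monom 1 1 * q) mod f)"
    if "Suc i < N" "degree q < N" for i q
  proof -
    have "cv (monom 1 (Suc i)) = Comp *\<^sub>v cv (monom 1 i)"
      using that by (simp add: Mul_cv degree_monom_eq mult_monom mod_id)
    then have "?B (monom 1 (Suc i)) q = cv (monom 1 i) \<bullet> (Comp\<^sup>T *\<^sub>v (G *\<^sub>v cv q))"
      using G by (simp add: scalar_prod_mult_transpose[of _ N N])
    also have "Comp\<^sup>T *\<^sub>v (G *\<^sub>v cv q) = (Comp\<^sup>T * G) *\<^sub>v cv q"
      by (rule assoc_mult_mat_vec[symmetric, of _ N N _ N]) (use G in auto)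
    also have "\<dots> = G *\<^sub>v (Comp *\<^sub>v cv q)"
      unfolding Gsym by (rule assoc_mult_mat_vec[of _ N N _ N]) (use G in auto)
    finally show ?thesis using that by (simp add: Mul_cv)
  qed
  \<comment> \<open>Iterating the shift moves all of \<beta>^i into the second argument and leaves 1
    in the first.\<close>
  have toone: "?B (monom 1 i) q = ?B 1 ((monom 1 i * q) mod f)" if "i < N" "degree q < N" for i q
    using that
  proof (induction i arbitrary: q)
    case 0
    then show ?case by (simp add: mod_id one_pCons monom_0)
  next
    case (Suc i)
    have "?B (monom 1 (Suc i)) q = ?B (monom 1 i) ((monom 1 1 * q) mod f)"
      by (rule shift[OF Suc.prems])
    also have "\<dots> = ?B 1 ((monom 1 i * ((monom 1 1 * q) mod f)) mod f)"
      by (rule Suc.IH) (use Suc.prems in auto)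
    also have "(monom 1 i * ((monom 1 1 * q) mod f)) mod f = (monom 1 (Suc i) * q) mod f"
      by (simp add: mod_mult_right_eq mult.assoc[symmetric] mult_monom)
    finally show ?case .
  qed
  \<comment> \<open>The unit is matched on pairings with 1 only; \<open>toone\<close> extends the
    agreement to the whole Gram matrix.\<close>
  obtain a where a: "degree a < N"
    and aB: "\<And>i. i < N \<Longrightarrow> form_alpha f a (monom 1 i) 1 = ?B (monom 1 i) 1"
    using functional_representation[of "\<lambda>i. ?B (monom 1 i) 1"] by blast
  have Gt: "G\<^sup>T = G" using P by (simp add: G_def transpose_mult_N J_transpose assoc_N)
  have Bsym: "?B p q = ?B q p" for p q
  proof -
    have "?B p q = (G *\<^sub>v cv q) \<bullet> cv p"
      by (rule comm_scalar_prod[of _ N]) (use G in auto)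
    then show ?thesis using G Gt scalar_prod_mult_transpose[OF G, of "cv q" "cv p"] by simp
  qed
  have one_N: "degree (1 :: 'k poly) < N" using N_pos by simp
  have lin1: "Gram a *\<^sub>v cv 1 = G *\<^sub>v cv 1"
  proof (rule eq_vecI)
    fix i assume "i < dim_vec (G *\<^sub>v cv 1)"
    then have i: "i < N" using G by simp
    have e: "(M *\<^sub>v cv 1) $ i = cv (monom 1 i) \<bullet> (M *\<^sub>v cv 1)" if "M \<in> carrier_mat N N" for M
      using that i by (simp add: unit_vec_of_poly scalar_prod_left_unit[of _ N])
    show "(Gram a *\<^sub>v cv 1) $ i = (G *\<^sub>v cv 1) $ i"
      unfolding e[OF G] e[OF Gram_carrier]
      using aB[OF i] i one_N by (simp add: Gram_cv degree_monom_eq)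
  qed (use G in auto)
  have "Gram a = G"
  proof (rule eq_matI)
    fix i j assume "i < dim_row G" "j < dim_col G"
    then have ij: "i < N" "j < N" using G by auto
    let ?q = "(monom 1 i * monom 1 j) mod f :: 'k poly"
    have "Gram a $$ (i, j) = form_alpha f a ?q 1"
      using ij by (simp add: Gram_def form_alpha_def mod_mult_left_eq mod_mult_right_eq ac_simps)
    also have "\<dots> = cv ?q \<bullet> (Gram a *\<^sub>v cv 1)" using one_N by (simp add: Gram_cv)
    also have "\<dots> = ?B 1 ?q" by (simp add: lin1 Bsym)
    also have "\<dots> = ?B (monom 1 i) (monom 1 j)"
      using ij by (simp add: toone degree_monom_eq)
    also have "\<dots> = G $$ (i, j)"
      using ij G by (simp add: unit_vec_of_poly scalar_prod_left_unit[of _ N] scalar_prod_right_unit)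
    finally show "Gram a $$ (i, j) = G $$ (i, j)" .
  qed (use G in auto)
  then have R: "realizes P a T" using P detP T TP by (simp add: realizes_def G_def)
  have "det G = det P * (det J * det P)"
    using P by (simp add: G_def det_mult[of _ N] det_transpose)
  then have "det (Gram a) \<noteq> 0" using detP det_J \<open>Gram a = G\<close> by simp
  then have "a \<in> Lunits f" using a det_Gram[of a] by (auto simp: Lunits_iff)
  then show ?thesis using R by blast
qed

end


section \<open>Orbits and square classes\<close>

text \<open>A relation R that is total on X, saturated under s and compatible with r and s matches
  r-classes with the s-classes it meets. That r is an equivalence is pulled back from s through
  R.\<close>

lemma bij_betw_quotients:
  assumes s: "equiv Y s" and r: "r \<subseteq> X \<times> X"
    and ex: "\<And>x. x \<in> X \<Longrightarrow> \<exists>y \<in> Y. R x y"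
    and iff: "\<And>x x' y y'. x \<in> X \<Longrightarrow> x' \<in> X \<Longrightarrow> y \<in> Y \<Longrightarrow> y' \<in> Y \<Longrightarrow> R x y \<Longrightarrow> R x' y' \<Longrightarrow>
      (x, x') \<in> r \<longleftrightarrow> (y, y') \<in> s"
    and closed: "\<And>x y y'. x \<in> X \<Longrightarrow> R x y \<Longrightarrow> (y, y') \<in> s \<Longrightarrow> R x y'"
  shows "\<exists>\<phi>. bij_betw \<phi> (X // r) {C \<in> Y // s. \<forall>y \<in> C. \<exists>x \<in> X. R x y}"
proof -
  have s_sub: "s \<subseteq> Y \<times> Y" and s_refl: "\<And>y. y \<in> Y \<Longrightarrow> (y, y) \<in> s"
    using s by (auto simp: equiv_def refl_on_def)
  have r_refl: "(x, x) \<in> r" if "x \<in> X" for x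
    using ex[OF that] iff[OF that that] s_refl by blast
  have r_eq: "equiv X r"
  proof (rule equivI)
    show "refl_on X r" using r_refl r by (auto simp: refl_on_def)
    show "sym r"
    proof (rule symI)
      fix x x' assume xx: "(x, x') \<in> r"
      then have X: "x \<in> X" "x' \<in> X" using r by auto
      obtain y y' where y: "y \<in> Y" "R x y" "y' \<in> Y" "R x' y'" using ex X by metis
      then have "(y', y) \<in> s" using iff X xx s by (meson equivE symE)
      then show "(x', x) \<in> r" using iff X y by blast
    qed
    show "trans r"
    proof (rule transI)
      fix x x' x'' assume xx: "(x, x') \<in> r" "(x', x'') \<in> r"
      then have X: "x \<in> X" "x' \<in> X" "x'' \<in> X" using r by auto
      obtain y y' y'' where y: "y \<in> Y" "R x y" "y' \<in> Y" "R x' y'" "y'' \<in> Y" "R x'' y''"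
        using ex X by metis
      have "(y, y') \<in> s" "(y', y'') \<in> s" using iff X y xx by blast+
      then have "(y, y'') \<in> s" using s by (meson equivE transE)
      then show "(x, x'') \<in> r" using iff X y by blast
    qed
  qed (use r in auto)
  \<comment> \<open>The image collects all partners of all members of a class; by compatibility and
    saturation it is a single s-class.\<close>
  define \<phi> where "\<phi> = (\<lambda>O'. {y \<in> Y. \<exists>x \<in> O'. R x y})"
  have \<phi>_class: "\<phi> (r `` {x}) = s `` {y}" if x: "x \<in> X" and y: "y \<in> Y" "R x y" for x y
  proof
    show "\<phi> (r `` {x}) \<subseteq> s `` {y}"
      using iff[OF x _ y(1) _ y(2)] r by (auto simp: \<phi>_def)
    show "s `` {y} \<subseteq> \<phi> (r `` {x})"
      using closed[OF x y(2)] s_sub r_refl[OF x] by (auto simp: \<phi>_def)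
  qed
  have "bij_betw \<phi> (X // r) {C \<in> Y // s. \<forall>y \<in> C. \<exists>x \<in> X. R x y}"
  proof (rule bij_betw_imageI)
    show "inj_on \<phi> (X // r)"
    proof (rule inj_onI)
      fix A B assume "A \<in> X // r" "B \<in> X // r" and eq: "\<phi> A = \<phi> B"
      then obtain x x' where x: "x \<in> X" "A = r `` {x}" "x' \<in> X" "B = r `` {x'}"
        by (auto elim!: quotientE)
      obtain y y' where y: "y \<in> Y" "R x y" "y' \<in> Y" "R x' y'" using ex x by metis
      have "s `` {y} = s `` {y'}" using \<phi>_class x y eq by metis
      then have "(y, y') \<in> s" using s y by (simp add: eq_equiv_class)
      then have "(x, x') \<in> r" using iff x y by blast
      then show "A = B" using r_eq x by (simp add: equiv_class_eq)
    qed
    show "\<phi> ` (X // r) = {C \<in> Y // s. \<forall>y \<in> C. \<exists>x \<in> X. R x y}"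
    proof (intro equalityI subsetI)
      fix C assume "C \<in> \<phi> ` (X // r)"
      then obtain x where x: "x \<in> X" "C = \<phi> (r `` {x})" by (auto elim!: quotientE)
      obtain y where y: "y \<in> Y" "R x y" using ex x by metis
      have C: "C = s `` {y}" using \<phi>_class x y by metis
      then have "\<forall>y' \<in> C. R x y'" using closed x(1) y by blast
      then show "C \<in> {C \<in> Y // s. \<forall>y \<in> C. \<exists>x \<in> X. R x y}"
        using C y x(1) by (auto intro: quotientI)
    next
      fix C assume "C \<in> {C \<in> Y // s. \<forall>y \<in> C. \<exists>x \<in> X. R x y}"
      then obtain y where y: "y \<in> Y" "C = s `` {y}" and good: "\<forall>y \<in> C. \<exists>x \<in> X. R x y"
        by (auto elim!: quotientE)
      then obtain x where x: "x \<in> X" "R x y" using s_refl by blast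
      have "C = \<phi> (r `` {x})" using \<phi>_class x y by metis
      then show "C \<in> \<phi> ` (X // r)" using x by (auto intro: quotientI)
    qed
  qed
  then show ?thesis by blast
qed

section \<open>Realized units are those with split form\<close>

context split_quotient
begin

text \<open>The coordinate vectors of the isotropic polynomials become the columns of W, to which
  \<open>hyperbolic_basis\<close> applies.\<close>

lemma split_isometry:
  assumes det: "det (Gram b) \<noteq> 0" and w: "\<And>i. i < m \<Longrightarrow> degree (w i) < N"
    and ind: "\<And>c. (\<Sum>i<m. Polynomial.smult (c i) (w i)) = 0 \<Longrightarrow> \<forall>i<m. c i = 0"
    and iso: "\<And>i j. i < m \<Longrightarrow> j < m \<Longrightarrow> form_alpha f b (w i) (w j) = 0"
  obtains H where "H \<in> carrier_mat N N" "H\<^sup>T * (Gram b * H) = J"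
proof -
  define W where "W = mat N m (\<lambda>(i, j). coeff (w j) i)"
  have W: "W \<in> carrier_mat N m" by (simp add: W_def)
  have col: "col W j = cv (w j)" if "j < m" for j
    using that by (intro eq_vecI) (auto simp: W_def)
  have "W\<^sup>T * (Gram b * W) = 0\<^sub>m m m"
  proof (rule eq_matI)
    fix i j assume "i < dim_row (0\<^sub>m m m :: 'k mat)" "j < dim_col (0\<^sub>m m m :: 'k mat)"
    then have ij: "i < m" "j < m" by auto
    then show "(W\<^sup>T * (Gram b * W)) $$ (i, j) = 0\<^sub>m m m $$ (i, j)"
      using w iso by (simp only: index_transpose_mult_mult[OF W Gram_carrier W ij] col Gram_cv) simp
  qed (use W in auto)
  moreover have "c = 0\<^sub>v m" if c: "c \<in> carrier_vec m" and 0: "W *\<^sub>v c = 0\<^sub>v N" for c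
  proof -
    have "(\<Sum>i<m. Polynomial.smult (c $ i) (w i)) = 0"
    proof (rule poly_eqI)
      fix r
      show "coeff (\<Sum>i<m. Polynomial.smult (c $ i) (w i)) r = coeff 0 r"
      proof (cases "r < N")
        case True
        have "coeff (\<Sum>i<m. Polynomial.smult (c $ i) (w i)) r = (W *\<^sub>v c) $ r"
          using True c by (simp add: W_def coeff_sum scalar_prod_def lessThan_atLeast0 mult.commute)
        then show ?thesis using 0 True by simp
      next
        case False
        then have "coeff (w i) r = 0" if "i < m" for i using w[OF that] by (simp add: coeff_eq_0)
        then show ?thesis by (simp add: coeff_sum)
      qed
    qed
    then have "\<forall>i<m. c $ i = 0" by (rule ind)
    then show ?thesis using c by (intro eq_vecI) auto
  qed
  ultimately show thesis
    using hyperbolic_basis[OF two, of "Gram b" m W] that det W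
    unfolding N_eq[symmetric] J_def[symmetric] by (metis Gram_carrier Gram_transpose)
qed

lemma det_mult_transpose:
  fixes A B :: "'k mat"
  assumes "A \<in> carrier_mat N N" "B \<in> carrier_mat N N"
  shows "det (A\<^sup>T * (B * A)) = det A * det A * det B"
  using assms by (simp add: det_mult[of _ N] det_transpose)

text \<open>The trace form of \<open>\<alpha> = 1\<close> is itself split, because \<open>1, \<beta>, \<dots>, \<beta>\<^sup>n\<close> span an isotropic
  subspace; this gives its discriminant.\<close>

lemma Gram_1_isometry:
  obtains H where "H \<in> carrier_mat N N" "H\<^sup>T * (Gram 1 * H) = J"
proof (rule split_isometry[OF det_Gram_1, of "\<lambda>i. monom 1 i"])
  show "degree (monom (1 :: 'k) i) < N" if "i < m" for i
    using that by (simp add: degree_monom_eq N_eq)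
  show "\<forall>i<m. c i = 0" if "(\<Sum>i<m. Polynomial.smult (c i) (monom 1 i)) = 0" for c :: "nat \<Rightarrow> 'k"
  proof (intro allI impI)
    fix j assume "j < m"
    have "coeff (\<Sum>i<m. Polynomial.smult (c i) (monom 1 i)) j = (\<Sum>i<m. if i = j then c i else 0)"
      by (simp add: coeff_sum if_distrib cong: if_cong)
    then show "c j = 0" using that \<open>j < m\<close> by simp
  qed
  show "form_alpha f 1 (monom 1 i) (monom 1 j) = 0" if "i < m" "j < m" for i j
  proof -
    \<comment> \<open>Here i and j are at most n, so i + j is at most 2n, one below N - 1: the
      product is not reduced and has no coefficient at N - 1.\<close>
    have "i + j < N - 1" using that by (simp add: N_eq m_eq)
    then show ?thesis
      by (simp add: form_alpha_def mult_monom mod_id degree_monom_eq deg)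
  qed
qed (use that in blast)

text \<open>Both \<open>Gram a\<close> and \<open>Gram 1\<close> are congruent to \<open>J\<close>,
  through P and H; dividing the determinants exhibits det P * det H as a square root of the
  norm.\<close>

lemma realizes_norm_trivial:
  assumes "realizes P a T"
  shows "norm_trivial f a"
proof -
  note P = realizesD[OF assms]
  obtain H where H: "H \<in> carrier_mat N N" "H\<^sup>T * (Gram 1 * H) = J" using Gram_1_isometry .
  have dH: "det H * det H * det (Gram 1) = det J"
    unfolding H(2)[symmetric] by (rule det_mult_transpose[symmetric, OF H(1) Gram_carrier])
  have "det (Gram 1) * det (Mul a) = det P * det P * det J"
    unfolding det_Gram[symmetric] P(5)[symmetric] by (rule det_mult_transpose[OF P(1) J_carrier])
  also have "\<dots> = det (Gram 1) * ((det P * det H) * (det P * det H))"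
    unfolding dH[symmetric] by (simp add: ac_simps)
  finally have "det (Mul a) = (det P * det H) * (det P * det H)" using det_Gram_1 by simp
  moreover have "det P * det H \<noteq> 0" using P(2) dH det_J by auto
  ultimately show ?thesis unfolding norm_trivial_def Lnorm_eq by blast
qed

lemma form_alpha_nondegenerate:
  assumes a: "a \<in> Lunits f" and l: "l \<in> Lset f" and 0: "\<And>q. q \<in> Lset f \<Longrightarrow> form_alpha f a l q = 0"
  shows "l = 0"
proof -
  have "(a * l) mod f = 0"
  proof (rule form_alpha_1_nondegenerate)
    fix q :: "'k poly" assume "degree q < N"
    then show "form_alpha f 1 ((a * l) mod f) q = 0"
      using 0 by (simp add: Lset_iff form_alpha_mod form_alpha_mult)
  qed simp
  then have "Mul a *\<^sub>v cv l = 0\<^sub>v N" using l by (simp add: Mul_cv Lset_iff) (intro eq_vecI, auto)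
  then have "cv l = 0\<^sub>v N"
    using a det_0_iff_vec_prod_zero_field[OF Mul_carrier, of a] vec_of_poly_carrier
    unfolding Lunits_iff by blast
  then have "cv l = cv 0" by (metis eq_vecI coeff_0 index_zero_vec vec_of_poly_dim vec_of_poly_index)
  then show ?thesis using l N_pos by (intro vec_of_poly_inj[of _ N]) (auto simp: Lset_iff)
qed

text \<open>The first m basis vectors of U span an isotropic subspace; their preimages under P, the
  first m columns of its inverse Q, give the required family.\<close>

lemma realizes_form_split:
  assumes R: "realizes P a T" and a: "a \<in> Lunits f"
  shows "form_split n f (form_alpha f a)"
proof -
  note P = realizesD[OF R]
  obtain Q where Q: "Q \<in> carrier_mat N N" "P * Q = 1\<^sub>m N" "Q * P = 1\<^sub>m N"
    using obtain_inverse_mat[OF P(1,2)] .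
  have mN: "i < N" if "i < m" for i using that by (simp add: N_eq)
  have "Q\<^sup>T * (Gram a * Q) = (P * Q)\<^sup>T * (J * (P * Q))"
    unfolding P(5)[symmetric] using P(1) Q(1) by (simp add: transpose_mult_N assoc_N)
  also have "\<dots> = J" by (simp add: Q right_mult_one_mat[OF J_carrier])
  finally have QJ: "Q\<^sup>T * (Gram a * Q) = J" .
  define w where "w i = coeffs_poly (col Q i)" for i
  have c: "col Q i \<in> carrier_vec N" for i using Q by auto
  have w: "degree (w i) < N" "cv (w i) = col Q i" for i
    unfolding w_def using degree_coeffs_poly[OF c N_pos] vec_of_coeffs_poly[OF c] by auto
  have iso: "form_alpha f a (w i) (w j) = 0" if "i < m" "j < m" for i j
  proof -
    have "form_alpha f a (w i) (w j) = (Q\<^sup>T * (Gram a * Q)) $$ (i, j)"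
      using index_transpose_mult_mult[OF Q(1) Gram_carrier Q(1) mN mN] that w by (metis Gram_cv)
    also have "\<dots> = 0" unfolding QJ J_def using that by (simp add: hyp_mat_def)
    finally show ?thesis .
  qed
  have ind: "\<forall>i<m. c i = 0" if 0: "(\<Sum>i<m. Polynomial.smult (c i) (w i)) = 0" for c
  proof -
    define v where "v = vec N (\<lambda>i. if i < m then c i else 0)"
    have v: "v \<in> carrier_vec N" by (simp add: v_def)
    have "Q *\<^sub>v v = 0\<^sub>v N"
    proof (rule eq_vecI)
      fix r assume "r < dim_vec (0\<^sub>v N :: 'k vec)"
      then have r: "r < N" by simp
      have "(Q *\<^sub>v v) $ r = (\<Sum>i<m + m. Q $$ (r, i) * (if i < m then c i else 0))"
        using r Q by (simp add: v_def scalar_prod_def lessThan_atLeast0 N_eq)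
      also have "\<dots> = (\<Sum>i<m. c i * Q $$ (r, i))"
        by (simp add: sum_lessThan_add mult.commute)
      also have "\<dots> = (\<Sum>i<m. c i * coeff (w i) r)"
      proof (intro sum.cong refl)
        fix i assume "i \<in> {..<m}"
        then have "coeff (w i) r = Q $$ (r, i)"
          using arg_cong[OF w(2)[of i], of "\<lambda>u. u $ r"] r Q mN by simp
        then show "c i * Q $$ (r, i) = c i * coeff (w i) r" by simp
      qed
      also have "\<dots> = coeff (\<Sum>i<m. Polynomial.smult (c i) (w i)) r" by (simp add: coeff_sum)
      finally show "(Q *\<^sub>v v) $ r = 0\<^sub>v N $ r" using 0 r by simp
    qed (use Q in auto)
    moreover have "v = P *\<^sub>v (Q *\<^sub>v v)"
      using assoc_mult_mat_vec[OF P(1) Q(1) v] Q(2) v by simp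
    moreover have "P *\<^sub>v 0\<^sub>v N = 0\<^sub>v N" using P(1) by (intro eq_vecI) (auto simp: scalar_prod_def)
    ultimately have "v = 0\<^sub>v N" by simp
    then have "v $ i = 0" if "i < m" for i using mN[OF that] by simp
    then show ?thesis using mN by (simp add: v_def)
  qed
  show ?thesis
    unfolding form_split_def m_eq[symmetric]
  proof (intro conjI exI[of _ w])
    show "\<forall>l \<in> Lset f. (\<forall>q \<in> Lset f. form_alpha f a l q = 0) \<longrightarrow> l = 0"
      using form_alpha_nondegenerate[OF a] by blast
    show "\<forall>i<m. w i \<in> Lset f" using w by (simp add: Lset_iff)
    show "\<forall>c. (\<Sum>i<m. Polynomial.smult (c i) (w i)) = 0 \<longrightarrow> (\<forall>i<m. c i = 0)" using ind by blast
    show "\<forall>i<m. \<forall>j<m. form_alpha f a (w i) (w j) = 0" using iso by blast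
  qed
qed

lemma split_realizes:
  assumes a: "a \<in> Lunits f" and split: "form_split n f (form_alpha f a)"
  shows "\<exists>T \<in> Vf n f. \<exists>P. realizes P a T"
proof -
  have dG: "det (Gram a) \<noteq> 0" using a det_Gram_1 det_Gram[of a] by (simp add: Lunits_iff)
  from split obtain w :: "nat \<Rightarrow> 'k poly" where w: "\<forall>i<m. degree (w i) < N"
    "\<forall>c. (\<Sum>i<m. Polynomial.smult (c i) (w i)) = 0 \<longrightarrow> (\<forall>i<m. c i = 0)"
    "\<forall>i<m. \<forall>j<m. form_alpha f a (w i) (w j) = 0"
    unfolding form_split_def m_eq[symmetric] Lset_iff by (elim conjE exE)
  obtain H where H: "H \<in> carrier_mat N N" and HJ: "H\<^sup>T * (Gram a * H) = J"
    by (rule split_isometry[OF dG, of w]) (use w in simp_all)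
  have dH: "det H \<noteq> 0" using det_mult_transpose[OF H Gram_carrier, of a] HJ det_J by auto
  obtain P where P: "P \<in> carrier_mat N N" and HP: "H * P = 1\<^sub>m N" and PH: "P * H = 1\<^sub>m N"
    using obtain_inverse_mat[OF H dH] .
  have "det H * det P = 1" using det_mult[OF H P] HP by simp
  then have dP: "det P \<noteq> 0" by auto
  have "P\<^sup>T * H\<^sup>T = 1\<^sub>m N" using transpose_mult_N[OF H P] HP by simp
  note cPH = cancel_inverse[OF _ _ this]
  have PJP: "P\<^sup>T * (J * P) = Gram a"
    unfolding HJ[symmetric] using H P cPH HP by (simp add: assoc_N right_mult_one_mat[OF Gram_carrier])
  \<comment> \<open>H goes from U to L and P back, so this is multiplication by \<beta> transported
    to U.\<close>
  define T where "T = P * (Comp * H)"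
  have T: "T \<in> carrier_mat N N" using P H by (simp add: T_def)
  have TP: "T * P = P * Comp"
    unfolding T_def using P H HP by (simp add: assoc_N right_mult_one_mat[OF Mul_carrier])
  have "similar_mat T Comp"
    by (rule similar_matI[of _ _ P H N]) (use T P H HP PH in \<open>auto simp: T_def assoc_N\<close>)
  then have "char_poly T = f" using char_poly_similar char_poly_Comp by metis
  moreover have "T\<^sup>T * J = J * T"
  proof -
    have "T\<^sup>T * J = H\<^sup>T * (Comp\<^sup>T * (P\<^sup>T * (H\<^sup>T * (Gram a * H))))"
      unfolding HJ T_def using P H by (simp add: transpose_mult_N assoc_N)
    also have "\<dots> = H\<^sup>T * ((Comp\<^sup>T * Gram a) * H)" using P H cPH by (simp add: assoc_N)
    also have "Comp\<^sup>T * Gram a = Gram a * Comp" by (simp add: Gram_mult Mul_transpose_Gram)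
    also have "H\<^sup>T * (Gram a * Comp * H) = H\<^sup>T * (Gram a * (H * (P * (Comp * H))))"
      using P H cancel_inverse[OF H P HP] by (simp add: assoc_N)
    also have "\<dots> = J * T" unfolding HJ[symmetric] T_def using P H by (simp add: assoc_N)
    finally show ?thesis .
  qed
  ultimately have "T \<in> Vf n f" using T by (simp add: Vf_iff)
  moreover have "realizes P a T" using P dP T TP PJP by (simp add: realizes_def)
  ultimately show ?thesis by blast
qed

section \<open>Square classes and the bijection\<close>

lemma Lunits_mult: "a \<in> Lunits f \<Longrightarrow> b \<in> Lunits f \<Longrightarrow> (a * b) mod f \<in> Lunits f"
  by (simp add: Lunits_iff Mul_mod Mul_mult[symmetric] det_mult[of _ N])

lemma mod_mult_square: "(a * (x mod f) * (x mod f)) mod f = (a * x * x) mod f"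
  by (metis mod_mult_left_eq mod_mult_right_eq)

lemma equiv_sq_rel: "equiv (Lunits f) (sq_rel f)"
proof (rule equivI)
  have "1 \<in> Lunits f" using N_pos by (simp add: Lunits_iff Mul_1)
  moreover have "a = (a * 1 * 1) mod f" if "a \<in> Lunits f" for a
    using that by (simp add: Lunits_iff mod_id)
  ultimately show "refl_on (Lunits f) (sq_rel f)"
    unfolding refl_on_def sq_rel_def by blast
  show "sym (sq_rel f)"
  proof (rule symI)
    fix a a' assume "(a, a') \<in> sq_rel f"
    then obtain l where a: "a \<in> Lunits f" and a': "a' \<in> Lunits f" and l: "l \<in> Lunits f"
      and eq: "a' = (a * l * l) mod f" by (auto simp: sq_rel_def)
    obtain k where k: "k \<in> Lset f" "(l * k) mod f = 1" using l by (auto simp: Lunits_def)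
    then have "k \<in> Lunits f" using l by (auto simp: Lunits_def mult.commute)
    moreover have "(a' * k * k) mod f = (a * ((l * k) mod f) * ((l * k) mod f)) mod f"
      unfolding eq mod_mult_square by (metis (no_types) mod_mult_left_eq mult.assoc mult.commute)
    then have "a = (a' * k * k) mod f" using a k by (simp add: Lunits_iff mod_id)
    ultimately show "(a', a) \<in> sq_rel f" using a a' by (auto simp: sq_rel_def)
  qed
  show "trans (sq_rel f)"
  proof (rule transI)
    fix a b c assume "(a, b) \<in> sq_rel f" "(b, c) \<in> sq_rel f"
    then obtain l k where u: "a \<in> Lunits f" "c \<in> Lunits f" "l \<in> Lunits f" "k \<in> Lunits f"
      and eq: "b = (a * l * l) mod f" "c = (b * k * k) mod f" by (auto simp: sq_rel_def)
    let ?h = "(l * k) mod f"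
    have "c = (a * ?h * ?h) mod f"
      unfolding eq mod_mult_square by (metis (no_types) mod_mult_left_eq mult.assoc mult.commute)
    then show "(a, c) \<in> sq_rel f" using u Lunits_mult[OF u(3,4)] by (auto simp: sq_rel_def)
  qed
qed (auto simp: sq_rel_def)

lemma realizes_sq_rel:
  assumes R: "realizes P a T" and s: "(a, a') \<in> sq_rel f"
  shows "\<exists>P'. realizes P' a' T"
proof -
  obtain l where l: "l \<in> Lunits f" "a' = (a * l * l) mod f" using s by (auto simp: sq_rel_def)
  then have "Gram a' = Gram (a * l * l)" by (simp add: Gram_def form_alpha_mod)
  then show ?thesis
    using realizes_mult[OF R, of l] l(1) by (auto simp: realizes_def Lunits_iff)
qed

text \<open>The two conditions defining \<open>split_classes\<close> hold for a unit exactly when it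
  is realized by some operator, so these classes are the ones met by the relation.\<close>

lemma bij_orbits_split_classes: "\<exists>\<phi>. bij_betw \<phi> (orbits n f) (split_classes n f)"
proof -
  let ?R = "\<lambda>T a. \<exists>P. realizes P a T"
  have "(norm_trivial f a \<and> form_split n f (form_alpha f a)) \<longleftrightarrow> (\<exists>T \<in> Vf n f. ?R T a)"
    if "a \<in> Lunits f" for a
    using that split_realizes realizes_norm_trivial realizes_form_split by blast
  then have "split_classes n f = {C \<in> Lunits f // sq_rel f. \<forall>a \<in> C. \<exists>T \<in> Vf n f. ?R T a}"
    unfolding split_classes_def using in_quotient_imp_subset[OF equiv_sq_rel] by blast
  moreover have "\<exists>\<phi>. bij_betw \<phi> (Vf n f // conj_rel n f)
      {C \<in> Lunits f // sq_rel f. \<forall>a \<in> C. \<exists>T \<in> Vf n f. ?R T a}"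
  proof (rule bij_betw_quotients[OF equiv_sq_rel])
    show "conj_rel n f \<subseteq> Vf n f \<times> Vf n f" by (auto simp: conj_rel_def)
    show "\<exists>a \<in> Lunits f. ?R T a" if "T \<in> Vf n f" for T by (rule exists_realizes[OF that])
    show "(T, T') \<in> conj_rel n f \<longleftrightarrow> (a, a') \<in> sq_rel f"
      if T: "T \<in> Vf n f" "T' \<in> Vf n f" and a: "a \<in> Lunits f" "a' \<in> Lunits f"
        and R: "?R T a" "?R T' a'" for T T' a a'
    proof -
      obtain P P' where "realizes P a T" "realizes P' a' T'" using R by blast
      from conj_iff_sq[OF this a] show ?thesis using T a by (simp add: conj_rel_def sq_rel_def)
    qed
    show "?R T a'" if "?R T a" "(a, a') \<in> sq_rel f" for T a a'
      using that realizes_sq_rel by blast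
  qed
  ultimately show ?thesis by (simp only: orbits_def)
qed

end

theorem theorem2p5:
  fixes f :: "'k::field poly" and n :: nat
  assumes char_not_2: "(2::'k) \<noteq> 0"
    and monic: "lead_coeff f = 1"
    and deg: "degree f = 2*n+2"
    and no_repeated_roots: "coprime f (pderiv f)"
  shows "\<exists>\<phi>. bij_betw \<phi> (orbits n f) (split_classes n f)"
proof -
  interpret split_quotient f "2 * n + 2" n "Suc n"
    by unfold_locales (use assms in auto)
  show ?thesis by (rule bij_orbits_split_classes)
qed

end
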